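(* Let $F=f+h$ be as in the context, and suppose $f$ is H\"older smooth with exponent $\nu\in[0,1]$ and constant $L_\nu>0$. Let $y_0\in\operatorname{dom}F$, $\rho>0$, $\beta\in(0,1)$, and suppose there is a constant $D>0$ with $D\ge \sup\{\operatorname{dist}(x,X^\star)\mid F(x)\le F(y_0)\}$. For any $\epsilon\in(0,F(y_0)-F^\star)$, let $T_{\mathrm{total}}$ denote the total number of inner iterations (summed over all outer iterations) required by the classical proximal bundle method, started at $y_0$ with parameters $\rho,\beta$, to obtain an outer iterate $y_k$ satisfying $F(y_k)-F^\star\le\epsilon$. Set $$T_{\mathrm{outer}}:=\left\lceil \frac{2\rho D^2}{\beta\epsilon}\right\rceil+\left\lceil\frac{\log_+\!\big((F(y_0)-F^\star)/(\rho D^2)\big)}{\log\!\big(1/(1-\beta/2)\big)}\right\rceil .$$ Then: (i) If $\nu=1$, $$T_{\mathrm{total}}\le T_{\mathrm{outer}}\times\left[2+\left\lceil\frac{\log_+\!\Big(\frac{L_1^2}{(1-\beta)\rho^2}\Big)}{\log\!\big(1+\frac{\rho}{L_1}\big)}\right\rceil\right].$$ (ii) If $\nu\in[0,1)$, $$T_{\mathrm{total}}\le T_{\mathrm{outer}}\times\left[3+4\log\Big(\frac1{1-\beta}\Big)+\frac{8}{1-\nu}\,\frac{L_\nu^{\frac{2}{1+\nu}}}{\rho(1-\beta)^{\frac{1-\nu}{1+\nu}}}\left(\frac{2\max\{\rho D^2,\epsilon\}}{\epsilon^2}\right)^{\frac{1-\nu}{1+\nu}}\right].$$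
   Context: Problem. $F=f+h$ on $\mathbb{R}^n$, where $f:\mathbb{R}^n\to\mathbb{R}$ is finite-valued and convex and $h:\mathbb{R}^n\to\mathbb{R}\cup\{+\infty\}$ is proper, lower semicontinuous and convex. $F$ attains its minimum value $F^\star$; $X^\star=\{x\mid F(x)=F^\star\}\neq\emptyset$. $\partial$ is the convex subdifferential, $\|\cdot\|$ the Euclidean norm, $\operatorname{dist}(x,X^\star)$ the Euclidean distance, $\log_+(t)=\max\{0,\log t\}$. H\"older smoothness with exponent $\nu\in[0,1]$ and constant $L_\nu$: $\|g_x-g_y\|\le L_\nu\|x-y\|^\nu$ for all $x,y\in\mathbb{R}^n$ and all $g_x\in\partial f(x)$, $g_y\in\partial f(y)$ (for $\nu=0$ the right-hand side is $L_0$). Inner procedure ProxBundle with center $\bar x\in\operatorname{dom}F$, parameter $\rho>0$ and a stopping test. Set $z_0=\bar x$. For $j=0,1,2,\dots$: choose any convex model $f_j:\mathbb{R}^n\to\mathbb{R}$ such that (1) $f_j(x)\le f(x)$ for all $x$; (2) for some $g_j\in\partial f(z_j)$, $f_j(x)\ge f(z_j)+\langle g_j,x-z_j\rangle$ for all $x$; (3) if $j\ge1$, there exist $a_j\in\partial f_{j-1}(z_j)$ and $b_j\in\partial h(z_j)$ with $a_j+b_j=\rho(\bar x-z_j)$ such that $f_j(x)\ge f_{j-1}(z_j)+\langle a_j,x-z_j\rangle$ for all $x$. Let $F_j=f_j+h$ and $z_{j+1}=\arg\min_x\{F_j(x)+\frac{\rho}{2}\|x-\bar x\|^2\}$. If the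 stopping test holds, stop and return $z_{j+1}$; otherwise continue with $j+1$. Each value of $j$ is one inner iteration. Classical proximal bundle method (PBM): given $y_0\in\operatorname{dom}F$, $\rho>0$, $\beta\in(0,1)$, for $k=0,1,2,\dots$ (outer iterations) let $y_{k+1}$ be the output of ProxBundle with center $\bar x=y_k$ and the descent test $$F(y_k)-F(z_{j+1})\ge\beta\big(F(y_k)-F_j(z_{j+1})\big).$$ *)

theory Defs
  imports "HOL-Analysis.Analysis"
begin

text \<open>
  Extended-valued functions have type \<^typ>\<open>'a \<Rightarrow> ereal\<close>. Properness excludes the value
  \<^term>\<open>-\<infinity> :: ereal\<close>, so the sums of extended reals below are never of the form
  \<^term>\<open>\<infinity> + (-\<infinity>) :: ereal\<close>.
\<close>

definition proper_fun :: "('a \<Rightarrow> ereal) \<Rightarrow> bool" where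
  "proper_fun \<phi> \<longleftrightarrow> (\<forall>x. \<phi> x \<noteq> -\<infinity>) \<and> (\<exists>x. \<phi> x \<noteq> \<infinity>)"

definition lsc_fun :: "('a::topological_space \<Rightarrow> ereal) \<Rightarrow> bool" where
  "lsc_fun \<phi> \<longleftrightarrow> (\<forall>x. \<phi> x \<le> Liminf (nhds x) \<phi>)"

definition convex_fun :: "('a::real_vector \<Rightarrow> ereal) \<Rightarrow> bool" where
  "convex_fun \<phi> \<longleftrightarrow> (\<forall>x y. \<forall>t\<in>{0<..<1::real}.
     \<phi> ((1 - t) *\<^sub>R x + t *\<^sub>R y) \<le> ereal (1 - t) * \<phi> x + ereal t * \<phi> y)"

definition subdifferential :: "('a::real_inner \<Rightarrow> ereal) \<Rightarrow> 'a \<Rightarrow> 'a set" where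
  "subdifferential \<phi> x = {g. \<bar>\<phi> x\<bar> \<noteq> \<infinity> \<and> (\<forall>y. \<phi> x + ereal (g \<bullet> (y - x)) \<le> \<phi> y)}"

abbreviation subdiff_real :: "('a::real_inner \<Rightarrow> real) \<Rightarrow> 'a \<Rightarrow> 'a set" where
  "subdiff_real f \<equiv> subdifferential (\<lambda>x. ereal (f x))"

text \<open>
  For \<open>\<nu> = 0\<close> the bound is \<open>L\<close> even when \<open>x = y\<close>; this case is separated because
  \<^term>\<open>0 powr 0 = (0::real)\<close>.
\<close>

definition hoelder_smooth :: "('a::real_inner \<Rightarrow> real) \<Rightarrow> real \<Rightarrow> real \<Rightarrow> bool" where
  "hoelder_smooth f \<nu> L \<longleftrightarrow>
     (\<forall>x y. \<forall>gx\<in>subdiff_real f x. \<forall>gy\<in>subdiff_real f y.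
        norm (gx - gy) \<le> L * (if \<nu> = 0 then 1 else norm (x - y) powr \<nu>))"

definition objective :: "('a \<Rightarrow> real) \<Rightarrow> ('a \<Rightarrow> ereal) \<Rightarrow> 'a \<Rightarrow> ereal" where
  "objective f h x = ereal (f x) + h x"

definition min_value :: "('a \<Rightarrow> ereal) \<Rightarrow> ereal" where
  "min_value F = (INF x. F x)"

definition minimizers :: "('a \<Rightarrow> ereal) \<Rightarrow> 'a set" where
  "minimizers F = {x. F x = min_value F}"

text \<open>
  In the inner procedure, \<open>z j\<close> are the trial points and \<open>m j\<close> the models.
\<close>

definition admissible_model ::
  "('a::real_inner \<Rightarrow> real) \<Rightarrow> ('a \<Rightarrow> ereal) \<Rightarrow> real \<Rightarrow> 'a \<Rightarrow> (nat \<Rightarrow> 'a) \<Rightarrow> (nat \<Rightarrow> 'a \<Rightarrow> real) \<Rightarrow> nat \<Rightarrow> bool"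
where
  "admissible_model f h \<rho> xbar z m j \<longleftrightarrow>
     convex_on UNIV (m j) \<and>
     (\<forall>x. m j x \<le> f x) \<and>
     (\<exists>g\<in>subdiff_real f (z j). \<forall>x. m j x \<ge> f (z j) + g \<bullet> (x - z j)) \<and>
     (j \<ge> 1 \<longrightarrow>
        (\<exists>a\<in>subdiff_real (m (j - 1)) (z j). \<exists>b\<in>subdifferential h (z j).
           a + b = \<rho> *\<^sub>R (xbar - z j) \<and>
           (\<forall>x. m j x \<ge> m (j - 1) (z j) + a \<bullet> (x - z j))))"

text \<open>
  \<open>stop \<phi> w\<close> is the stopping test, evaluated at the current model \<open>\<phi>\<close> and the
  new trial point \<open>w\<close>. Iteration \<open>j\<close> is performed iff the test failed in all earlier
  iterations; the entries of \<open>z\<close> and \<open>m\<close> beyond the last performed iteration are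
  unconstrained and irrelevant.
\<close>

definition prox_bundle ::
  "('a::real_inner \<Rightarrow> real) \<Rightarrow> ('a \<Rightarrow> ereal) \<Rightarrow> real \<Rightarrow> 'a \<Rightarrow> (('a \<Rightarrow> real) \<Rightarrow> 'a \<Rightarrow> bool)
     \<Rightarrow> (nat \<Rightarrow> 'a) \<Rightarrow> (nat \<Rightarrow> 'a \<Rightarrow> real) \<Rightarrow> bool"
where
  "prox_bundle f h \<rho> xbar stop z m \<longleftrightarrow>
     z 0 = xbar \<and>
     (\<forall>j. (\<forall>i<j. \<not> stop (m i) (z (Suc i))) \<longrightarrow>
        admissible_model f h \<rho> xbar z m j \<and>
        is_arg_min (\<lambda>x. objective (m j) h x + ereal (\<rho> / 2 * (norm (x - xbar))\<^sup>2)) (\<lambda>_. True) (z (Suc j)))"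

definition inner_iterations ::
  "(('a \<Rightarrow> real) \<Rightarrow> 'a \<Rightarrow> bool) \<Rightarrow> (nat \<Rightarrow> 'a) \<Rightarrow> (nat \<Rightarrow> 'a \<Rightarrow> real) \<Rightarrow> enat"
where
  "inner_iterations stop z m =
     (if \<exists>j. stop (m j) (z (Suc j))
      then enat (Suc (LEAST j. stop (m j) (z (Suc j))))
      else \<infinity>)"

definition descent_test ::
  "('a \<Rightarrow> real) \<Rightarrow> ('a \<Rightarrow> ereal) \<Rightarrow> real \<Rightarrow> 'a \<Rightarrow> ('a \<Rightarrow> real) \<Rightarrow> 'a \<Rightarrow> bool"
where
  "descent_test f h \<beta> y \<phi> w \<longleftrightarrow>
     objective f h y - objective f h w \<ge> ereal \<beta> * (objective f h y - objective \<phi> h w)"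

text \<open>
  In a run of the outer method, \<open>y k\<close> are the outer iterates and \<open>z k\<close>, \<open>m k\<close> the trial
  points and models of the inner procedure centred at \<open>y k\<close>. If some inner procedure never
  stops, later outer iterates do not exist and the corresponding entries are unconstrained.
\<close>

definition pbm_iterations ::
  "('a \<Rightarrow> real) \<Rightarrow> ('a \<Rightarrow> ereal) \<Rightarrow> real \<Rightarrow>
     (nat \<Rightarrow> 'a) \<Rightarrow> (nat \<Rightarrow> nat \<Rightarrow> 'a) \<Rightarrow> (nat \<Rightarrow> nat \<Rightarrow> 'a \<Rightarrow> real) \<Rightarrow> nat \<Rightarrow> enat"
where
  "pbm_iterations f h \<beta> y z m k = inner_iterations (descent_test f h \<beta> (y k)) (z k) (m k)"

definition pbm_run ::
  "('a::real_inner \<Rightarrow> real) \<Rightarrow> ('a \<Rightarrow> ereal) \<Rightarrow> real \<Rightarrow> real \<Rightarrow> 'a \<Rightarrow>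
     (nat \<Rightarrow> 'a) \<Rightarrow> (nat \<Rightarrow> nat \<Rightarrow> 'a) \<Rightarrow> (nat \<Rightarrow> nat \<Rightarrow> 'a \<Rightarrow> real) \<Rightarrow> bool"
where
  "pbm_run f h \<rho> \<beta> y0 y z m \<longleftrightarrow>
     y 0 = y0 \<and>
     (\<forall>k. (\<forall>i<k. pbm_iterations f h \<beta> y z m i \<noteq> \<infinity>) \<longrightarrow>
        prox_bundle f h \<rho> (y k) (descent_test f h \<beta> (y k)) (z k) (m k) \<and>
        (\<forall>J. pbm_iterations f h \<beta> y z m k = enat J \<longrightarrow> y (Suc k) = z k J))"

definition pbm_reaches ::
  "('a \<Rightarrow> real) \<Rightarrow> ('a \<Rightarrow> ereal) \<Rightarrow> real \<Rightarrow> real \<Rightarrow>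
     (nat \<Rightarrow> 'a) \<Rightarrow> (nat \<Rightarrow> nat \<Rightarrow> 'a) \<Rightarrow> (nat \<Rightarrow> nat \<Rightarrow> 'a \<Rightarrow> real) \<Rightarrow> nat \<Rightarrow> bool"
where
  "pbm_reaches f h \<beta> \<epsilon> y z m k \<longleftrightarrow>
     (\<forall>i<k. pbm_iterations f h \<beta> y z m i \<noteq> \<infinity>) \<and>
     objective f h (y k) - min_value (objective f h) \<le> ereal \<epsilon>"

text \<open>
  The inner iterations performed up to the first \<open>\<epsilon>\<close>-optimal outer iterate; infinite if
  the run never produces one.
\<close>

definition pbm_total_iterations ::
  "('a \<Rightarrow> real) \<Rightarrow> ('a \<Rightarrow> ereal) \<Rightarrow> real \<Rightarrow> real \<Rightarrow>
     (nat \<Rightarrow> 'a) \<Rightarrow> (nat \<Rightarrow> nat \<Rightarrow> 'a) \<Rightarrow> (nat \<Rightarrow> nat \<Rightarrow> 'a \<Rightarrow> real) \<Rightarrow> enat"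
where
  "pbm_total_iterations f h \<beta> \<epsilon> y z m =
     (if \<exists>K. pbm_reaches f h \<beta> \<epsilon> y z m K
      then \<Sum>k < (LEAST K. pbm_reaches f h \<beta> \<epsilon> y z m K). pbm_iterations f h \<beta> y z m k
      else \<infinity>)"

definition log_plus :: "real \<Rightarrow> real" where
  "log_plus t = max 0 (ln t)"

text \<open>Here \<open>\<Delta>\<close> stands for the initial optimality gap.\<close>

definition outer_bound :: "real \<Rightarrow> real \<Rightarrow> real \<Rightarrow> real \<Rightarrow> real \<Rightarrow> int" where
  "outer_bound \<rho> \<beta> D \<epsilon> \<Delta> =
     \<lceil>2 * \<rho> * D\<^sup>2 / (\<beta> * \<epsilon>)\<rceil> + \<lceil>log_plus (\<Delta> / (\<rho> * D\<^sup>2)) / ln (1 / (1 - \<beta> / 2))\<rceil>"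

end

theory Submission
  imports Defs
begin

text \<open>
  Let \<open>M\<close> be the value at the centre \<open>y\<close> of the Moreau envelope of \<open>F\<close> with parameter \<open>\<rho>\<close>, and
  \<open>v = F y - M\<close>.

  Outer steps: the optimal value of every proximal subproblem is at most \<open>M\<close>, so a serious step
  decreases \<open>F\<close> by at least \<open>\<beta> * v\<close>, and testing the envelope on the segment from \<open>y\<close> to a minimizer
  gives \<open>v \<ge> t * \<delta> - \<rho> * D\<^sup>2 * t\<^sup>2 / 2\<close> for \<open>0 \<le> t \<le> 1\<close>, where \<open>\<delta>\<close> is the optimality gap of \<open>y\<close>.

  Inner steps: let \<open>w j\<close> be the difference of \<open>M\<close> and the optimal value of subproblem \<open>j\<close>, let \<open>e j\<close> be
  the model error at the new trial point and \<open>d j\<close> the length of the step to it. Then \<open>w j \<le> e j\<close> and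
  \<open>e j \<le> L / (1 + \<nu>) * d j powr (1 + \<nu>)\<close>, while \<open>w\<close> decreases by at least \<open>\<rho> / 2 * (d j)\<^sup>2\<close>, and a failed
  descent test forces \<open>(1 - \<beta>) * v < e j\<close>. For \<open>\<nu> = 1\<close> this makes \<open>w\<close> contract by the factor
  \<open>1 + \<rho> / L\<close>, starting from \<open>w 0 \<le> L / \<rho> * v\<close>. For \<open>\<nu> < 1\<close> the sequence \<open>x = w / ((1 - \<beta>) * v)\<close> satisfies
  \<open>x j - x (j + 1) \<ge> r * max 1 (x (j + 1)) powr (1 + p)\<close> with \<open>p = (1 - \<nu>) / (1 + \<nu>)\<close>. As long as
  \<open>r * x j powr p \<ge> 2\<close> it shrinks by the factor 3; if that happens at all then \<open>w 0 \<le> v\<close>, and these steps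
  account for the term \<open>ln (1 / (1 - \<beta>))\<close>.
\<close>

section \<open>Powers, subgradients and the descent inequality\<close>

text \<open>Weighted AM-GM for \<open>y\<close> and 1 with weights \<open>p\<close> and
  \<open>1 - p\<close>.\<close>

lemma powr_le_tangent_at_1:
  fixes y p :: real
  assumes "0 < y" "0 \<le> p" "p \<le> 1"
  shows "y powr p \<le> 1 + p * (y - 1)"
  using Youngs_inequality_0[of p "1 - p" y 1] assms by (simp add: algebra_simps)

text \<open>Bernoulli's inequality, from the concave case with exponent \<open>1 / q\<close> at the
  point \<open>y powr q\<close>.\<close>

lemma tangent_at_1_le_powr:
  fixes y q :: real
  assumes "0 < y" "1 \<le> q"
  shows "1 + q * (y - 1) \<le> y powr q"
proof -
  have "(y powr q) powr (1/q) \<le> 1 + (1/q) * (y powr q - 1)"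
    using assms by (intro powr_le_tangent_at_1) auto
  then have "y \<le> 1 + (1/q) * (y powr q - 1)"
    using assms by (simp add: powr_powr)
  then have "q * y \<le> q * (1 + (1/q) * (y powr q - 1))"
    using assms by (intro mult_left_mono) auto
  then show ?thesis
    using assms by (simp add: algebra_simps)
qed

text \<open>The modulus in \<open>hoelder_smooth\<close>: at \<open>\<nu> = 0\<close> it is 1 even
  for \<open>s = 0\<close>, where \<open>powr\<close> would give 0.\<close>

definition hpow :: "real \<Rightarrow> real \<Rightarrow> real" where
  "hpow \<nu> s = (if \<nu> = 0 then 1 else s powr \<nu>)"

text \<open>Tangent inequality at \<open>a\<close> for the convex function
  \<open>s powr (1 + \<nu>) / (1 + \<nu>)\<close>: Bernoulli's inequality at \<open>b / a\<close>,
  rescaled. Zero arguments are separate since that ratio must be positive.\<close>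

lemma powr_diff_ge:
  fixes a b \<nu> :: real
  assumes "0 \<le> a" "0 \<le> b" "0 \<le> \<nu>"
  shows "hpow \<nu> a * (b - a) \<le> (b powr (1 + \<nu>) - a powr (1 + \<nu>)) / (1 + \<nu>)"
proof (cases "a = 0 \<or> b = 0")
  case True
  have "a * hpow \<nu> a = a powr (1 + \<nu>)" 
    using assms by (auto simp: hpow_def powr_add)
  moreover have "a powr (1 + \<nu>) / (1 + \<nu>) \<le> a powr (1 + \<nu>)"
    using assms by (simp add: field_simps)
  ultimately show ?thesis using True assms by (auto simp: hpow_def algebra_simps)
next
  case False
  then have ab: "0 < a" "0 < b" using assms by auto
  have "1 + (1 + \<nu>) * (b / a - 1) \<le> (b / a) powr (1 + \<nu>)"
    using ab assms by (intro tangent_at_1_le_powr) auto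
  then have "a powr (1 + \<nu>) * (1 + (1 + \<nu>) * (b / a - 1)) \<le> a powr (1 + \<nu>) * (b / a) powr (1 + \<nu>)"
    by (intro mult_left_mono) auto
  also have "\<dots> = b powr (1 + \<nu>)"
    using ab by (simp add: powr_divide)
  also have "a powr (1 + \<nu>) * (1 + (1 + \<nu>) * (b / a - 1)) 
      = a powr (1 + \<nu>) + (1 + \<nu>) * (hpow \<nu> a * (b - a))"
    using ab by (simp add: hpow_def powr_add field_simps)
  finally show ?thesis
    using assms by (simp add: field_simps)
qed

lemma mem_subdiff_real_iff: "g \<in> subdiff_real f x \<longleftrightarrow> (\<forall>y. f x + g \<bullet> (y - x) \<le> f y)"
  by (simp add: subdifferential_def)

text \<open>Separate the epigraph from the open vertical ray below \<open>(x, f x)\<close>, which is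
  disjoint from it; the slope of the hyperplane is a subgradient.\<close>

lemma subdiff_real_nonempty:
  fixes f :: "'a::euclidean_space \<Rightarrow> real"
  assumes "convex_on UNIV f"
  shows "subdiff_real f x \<noteq> {}"
proof -
  let ?T = "epigraph UNIV f" and ?S = "{x} \<times> {..<f x}"
  have "convex ?T" using assms by (simp add: convex_epigraph)
  moreover have "convex ?S" by (intro convex_Times) auto
  moreover have "?T \<noteq> {}" by (auto simp: epigraph_def)
  moreover have "?S \<noteq> {}" using lt_ex by auto
  moreover have "?S \<inter> ?T = {}" by (auto simp: epigraph_def)
  ultimately obtain a b where a: "a \<noteq> 0" "\<forall>p\<in>?S. a \<bullet> p \<le> b" "\<forall>p\<in>?T. a \<bullet> p \<ge> b"
    using separating_hyperplane_sets[of ?S ?T] by blast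
  obtain u s where us: "a = (u, s)" by (cases a)
  have below: "u \<bullet> x + s * t \<le> b" if "t < f x" for t
    using a(2) that by (auto simp: us inner_prod_def)
  have above: "b \<le> u \<bullet> y + s * t" if "f y \<le> t" for y t
    using a(3) that by (auto simp: us inner_prod_def epigraph_def)
  have "s \<ge> 0"
    using below[of "f x - 1"] above[of x "f x"] by (simp add: algebra_simps)
  \<comment> \<open>A vertical hyperplane is impossible since \<open>f\<close> is finite at
    \<open>x - u\<close>: it would give \<open>u \<bullet> u \<le> 0\<close>.\<close>
  have "s \<noteq> 0"
  proof
    assume "s = 0"
    then have "u \<bullet> x \<le> u \<bullet> (x - u)"
      using below[of "f x - 1"] above[of "x - u" "f (x - u)"] by simp
    then have "u = 0"
      by (simp add: inner_diff_right) (metis inner_ge_zero inner_eq_zero_iff order_antisym)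
    then show False using a(1) us \<open>s = 0\<close> by (simp add: zero_prod_def)
  qed
  with \<open>s \<ge> 0\<close> have "s > 0" by simp
  have le: "u \<bullet> x + s * f x \<le> u \<bullet> y + s * f y" for y
  proof -
    have "f x \<le> (u \<bullet> y + s * f y - u \<bullet> x) / s"
    proof (rule dense_le)
      fix t assume "t < f x"
      then have "u \<bullet> x + s * t \<le> u \<bullet> y + s * f y"
        using below above[of y "f y"] by (meson order_refl order_trans)
      then show "t \<le> (u \<bullet> y + s * f y - u \<bullet> x) / s"
        using \<open>s > 0\<close> by (simp add: field_simps)
    qed
    then show ?thesis using \<open>s > 0\<close> by (simp add: field_simps)
  qed
  have "- (1/s) *\<^sub>R u \<in> subdiff_real f x"
    unfolding mem_subdiff_real_iff
    using le \<open>s > 0\<close> by (auto simp: field_simps inner_diff_right)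
  then show ?thesis by blast
qed

text \<open>As \<open>f\<close> may be nonsmooth, the usual integral along the segment is replaced
  by a Riemann sum: on each of \<open>n\<close> equal pieces a subgradient at the right end bounds
  the increment of \<open>f\<close>, and the Hoelder condition compares it with \<open>g\<close>.
  The error \<open>c 1 / n\<close> vanishes in the limit.\<close>

lemma hoelder_descent:
  fixes f :: "'a::euclidean_space \<Rightarrow> real"
  assumes f: "convex_on UNIV f" and hs: "hoelder_smooth f \<nu> L" and "0 \<le> \<nu>" "0 < L"
    and g: "g \<in> subdiff_real f x"
  shows "f y \<le> f x + g \<bullet> (y - x) + L / (1 + \<nu>) * norm (y - x) powr (1 + \<nu>)"
proof -
  define d where "d = y - x"
  define c where "c s = L * norm d * hpow \<nu> (s * norm d)" for s
  define C where "C s = L / (1 + \<nu>) * (s * norm d) powr (1 + \<nu>)" for s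
  have approx: "f y \<le> f x + g \<bullet> d + C 1 + c 1 / n" if "n > 0" for n :: nat
  proof -
    define p where "p k = x + (real k / n) *\<^sub>R d" for k :: nat
    (* C is convex with derivative c, so a step costs at most its increment of C plus a term that
       telescopes to c 1 / n. *)
    have "f (p k) \<le> f x + (k / n) * (g \<bullet> d) + C (k / n) + c (k / n) / n" for k
    proof (induction k)
      case 0
      then show ?case using \<open>L > 0\<close> by (simp add: p_def C_def c_def hpow_def)
    next
      case (Suc k)
      obtain g' where g': "g' \<in> subdiff_real f (p (Suc k))"
        using subdiff_real_nonempty[OF f] by blast
      have diff: "p k - p (Suc k) = - (1 / n) *\<^sub>R d"
      proof -
        have "real k / n - Suc k / n = - (1 / n)" by (simp add: diff_divide_distrib[symmetric])
        then show ?thesis by (simp only: p_def add_diff_cancel_left flip: scaleR_diff_left)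
      qed
      have "f (p (Suc k)) + g' \<bullet> (p k - p (Suc k)) \<le> f (p k)"
        using g' by (simp add: mem_subdiff_real_iff)
      then have 1: "f (p (Suc k)) \<le> f (p k) + (g' \<bullet> d) / n"
        by (simp add: diff)
      have "g' \<bullet> d = g \<bullet> d + (g' - g) \<bullet> d" by (simp add: inner_diff_left)
      also have "(g' - g) \<bullet> d \<le> norm (g' - g) * norm d" by (rule norm_cauchy_schwarz)
      also have "norm (g' - g) \<le> L * hpow \<nu> (norm (p (Suc k) - x))"
        using hs g g' unfolding hoelder_smooth_def hpow_def by auto
      also have "norm (p (Suc k) - x) = Suc k / n * norm d" by (simp add: p_def)
      finally have "g' \<bullet> d \<le> g \<bullet> d + c (Suc k / n)"
        by (simp add: c_def mult_ac mult_right_mono)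
      then have "(g' \<bullet> d) / n \<le> (g \<bullet> d) / n + c (Suc k / n) / n"
        by (simp add: divide_right_mono flip: add_divide_distrib)
      moreover have "c (k / n) / n \<le> C (Suc k / n) - C (k / n)"
      proof -
        define a where "a = k / n * norm d"
        define b where "b = Suc k / n * norm d"
        have "hpow \<nu> a * (b - a) \<le> (b powr (1 + \<nu>) - a powr (1 + \<nu>)) / (1 + \<nu>)"
          using assms by (intro powr_diff_ge) (auto simp: a_def b_def)
        from mult_left_mono[OF this, of L]
        have "L * (hpow \<nu> a * (b - a)) \<le> L * ((b powr (1 + \<nu>) - a powr (1 + \<nu>)) / (1 + \<nu>))"
          using \<open>L > 0\<close> by simp
        moreover have "b - a = norm d / n"
          by (simp add: a_def b_def diff_divide_distrib[symmetric] left_diff_distrib[symmetric] add_divide_distrib distrib_right)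
        ultimately have "L * (hpow \<nu> a * (norm d / n)) \<le> L * ((b powr (1 + \<nu>) - a powr (1 + \<nu>)) / (1 + \<nu>))"
          by simp
        then show ?thesis
          by (simp add: c_def C_def a_def b_def diff_divide_distrib right_diff_distrib mult_ac)
      qed
      ultimately show ?case using 1 Suc.IH
        by (simp add: add_divide_distrib algebra_simps)
    qed
    from this[of n] show ?thesis using that by (simp add: p_def d_def)
  qed
  have "(\<lambda>n. f x + g \<bullet> d + C 1 + c 1 / real n) \<longlonglongrightarrow> f x + g \<bullet> d + C 1 + 0"
    by (intro tendsto_intros lim_const_over_n)
  then have "f y \<le> f x + g \<bullet> d + C 1 + 0"
    by (rule LIMSEQ_le_const) (use approx in \<open>auto intro!: exI[of _ 1]\<close>)
  then show ?thesis by (simp add: C_def d_def)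
qed

section \<open>Counting lemmas\<close>

text \<open>The recursion is an implicit Euler step for the flow
  \<open>x' = - r * max 1 x powr (1 + p)\<close>. Along the flow \<open>x powr (- p)\<close> grows
  at rate \<open>p * r\<close> above 1, so coming down to 1 takes time at most
  \<open>1 / (p * r)\<close> from any height, and the rest takes \<open>1 / r\<close>. A discrete
  step falls behind only where \<open>r * x powr p\<close> is large; there \<open>x\<close> shrinks
  geometrically, which is counted by \<open>ln B\<close>.\<close>

lemma null_step_count:
  fixes x :: "nat \<Rightarrow> real" and r p B :: real
  assumes "0 < r" "0 < p" "p \<le> 1" "1 \<le> B"
    and nonneg: "\<And>j. j \<le> N \<Longrightarrow> 0 \<le> x j"
    and step: "\<And>j. j < N \<Longrightarrow> x (Suc j) + r * max 1 (x (Suc j)) powr (1 + p) \<le> x j"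
    and init: "2 \<le> r * x 0 powr p \<Longrightarrow> x 0 \<le> B"
  shows "real N \<le> 1 + ln B + 4 / (p * r)"
proof -
  \<comment> \<open>The threshold where \<open>r * t powr p\<close> reaches 2, cut off below at
    1.\<close>
  define \<theta> where "\<theta> = max 1 ((2 / r) powr (1 / p))"
  have \<theta>: "1 \<le> \<theta>" by (simp add: \<theta>_def)
  have \<theta>_iff: "\<theta> \<le> t \<longleftrightarrow> 1 \<le> t \<and> 2 \<le> r * t powr p" if "0 \<le> t" for t
  proof -
    have "(2 / r) powr (1 / p) \<le> t \<longleftrightarrow> 2 / r \<le> t powr p"
    proof
      assume "(2 / r) powr (1 / p) \<le> t"
      then have "((2 / r) powr (1 / p)) powr p \<le> t powr p"
        using assms by (intro powr_mono2) auto
      then show "2 / r \<le> t powr p" using assms by (simp add: powr_powr)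
    next
      assume "2 / r \<le> t powr p"
      then have "(2 / r) powr (1 / p) \<le> (t powr p) powr (1 / p)"
        using assms by (intro powr_mono2) auto
      then show "(2 / r) powr (1 / p) \<le> t" using assms that by (simp add: powr_powr)
    qed
    then show ?thesis using assms by (auto simp: \<theta>_def field_simps)
  qed
  (* A potential that drops by 1 in every step except the one that crosses 1: its three parts drop
     for x <= 1, for 1 < x < theta and for x >= theta (where x shrinks by a factor of 3). *)
  define K where "K = 3 / (p * r)"
  define \<Phi> where "\<Phi> t = min t 1 / r + (if 1 < t then 1 + K * (1 - t powr (- p)) else 0)
     + ln (max 1 (t / \<theta>))" for t :: real
  have K: "K > 0" using assms by (simp add: K_def)
  have powr_bound: "0 \<le> 1 - t powr (- p)" if "1 \<le> t" for t
    using that assms powr_mono[of "- p" 0 t] by simp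
  have \<Phi>_nonneg: "0 \<le> \<Phi> t" if "0 \<le> t" for t
    using that assms K powr_bound[of t] unfolding \<Phi>_def by (intro add_nonneg_nonneg) auto
  have \<Phi>_step: "\<Phi> s + 1 \<le> \<Phi> t" if s: "0 \<le> s" and le: "s + r * max 1 s powr (1 + p) \<le> t" for s t
  proof -
    have "s < t"
      by (rule less_le_trans[OF _ le]) (use assms in simp)
    have ln_mono: "ln (max 1 (s / \<theta>)) \<le> ln (max 1 (t / \<theta>))"
      using \<theta> \<open>s < t\<close> by (intro ln_mono) (auto simp: max_def field_simps)
    have min_mono: "min s 1 / r \<le> min t 1 / r"
      using \<open>s < t\<close> assms by (intro divide_right_mono) auto
    consider "s \<le> 1" "t \<le> 1" | "s \<le> 1" "1 < t" | "1 < s" by linarith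
    then show ?thesis
    proof cases
      case 1
      then have "s + r \<le> t" using le by simp
      then have "(s + r) / r \<le> t / r" using assms by (intro divide_right_mono) auto
      then have "s / r + 1 \<le> t / r" using assms by (simp add: add_divide_distrib)
      moreover have "\<Phi> s = s / r + ln (max 1 (s / \<theta>))" "\<Phi> t = t / r + ln (max 1 (t / \<theta>))"
        using 1 by (auto simp: \<Phi>_def min_def)
      ultimately show ?thesis using ln_mono by linarith
    next
      \<comment> \<open>The crossing step is paid for by the jump of \<open>\<Phi>\<close> by 1 just
        above 1.\<close>
      case 2
      then have "0 \<le> K * (1 - t powr (- p))" using powr_bound[of t] K by simp
      moreover have "\<Phi> s = min s 1 / r + ln (max 1 (s / \<theta>))"
        "\<Phi> t = min t 1 / r + (1 + K * (1 - t powr (- p))) + ln (max 1 (t / \<theta>))"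
        using 2 by (auto simp: \<Phi>_def)
      ultimately show ?thesis using ln_mono min_mono by linarith
    next
      case 3
      define \<sigma> where "\<sigma> = r * s powr p"
      have \<sigma>: "\<sigma> > 0" using 3 assms by (simp add: \<sigma>_def)
      have t: "s * (1 + \<sigma>) \<le> t" using le 3 by (simp add: \<sigma>_def powr_add algebra_simps)
      have "t > 1" using 3 \<open>s < t\<close> by simp
      have pw: "t powr (- p) \<le> s powr (- p) * (1 + \<sigma>) powr (- p)"
        using powr_mono2'[of "- p" "s * (1 + \<sigma>)" t] t 3 \<sigma> assms by (simp add: powr_mult)
      have sp: "0 < s powr (- p)" using 3 by simp
      show ?thesis
      proof (cases "\<theta> \<le> s")
        case True
        \<comment> \<open>Here \<open>t \<ge> (1 + \<sigma>) * s \<ge> 3 * s\<close>, so the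
          logarithm drops by at least \<open>ln 3 \<ge> 1\<close>.\<close>
        then have "\<sigma> \<ge> 2" using \<theta>_iff s by (simp add: \<sigma>_def)
        have "3 * s \<le> s * (1 + \<sigma>)" using \<open>\<sigma> \<ge> 2\<close> 3 by (simp add: algebra_simps)
        then have "3 * s \<le> t" using t by linarith
        then have "3 * (s / \<theta>) \<le> t / \<theta>" using \<theta> by (simp add: field_simps)
        moreover have s\<theta>: "1 \<le> s / \<theta>" using True \<theta> by simp
        ultimately have "ln (3 * (s / \<theta>)) \<le> ln (t / \<theta>)" by (subst ln_le_cancel_iff) linarith+
        moreover have "ln (3 * (s / \<theta>)) = ln 3 + ln (s / \<theta>)"
          using s\<theta> by (intro ln_mult_pos) auto
        moreover have "1 \<le> ln (3::real)"
          using exp_le by (simp add: ln_ge_iff)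
        moreover have "1 \<le> t / \<theta>"
          using \<open>3 * (s / \<theta>) \<le> t / \<theta>\<close> s\<theta> by linarith
        moreover have "K * (1 - s powr (- p)) \<le> K * (1 - t powr (- p))"
          using K \<open>s < t\<close> 3 assms by (intro mult_left_mono) (auto intro!: powr_mono2')
        moreover have "\<Phi> s = 1 / r + (1 + K * (1 - s powr (- p))) + ln (s / \<theta>)"
          using 3 s\<theta> unfolding \<Phi>_def max_absorb2[OF s\<theta>] by simp
        moreover have "max 1 (t / \<theta>) = t / \<theta>"
          using \<open>1 \<le> t / \<theta>\<close> by (rule max_absorb2)
        then have "\<Phi> t = 1 / r + (1 + K * (1 - t powr (- p))) + ln (t / \<theta>)"
          using \<open>t > 1\<close> unfolding \<Phi>_def by simp
        ultimately show ?thesis by linarith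
      next
        case False
        then have "\<sigma> < 2" using \<theta>_iff[of s] s 3 by (simp add: \<sigma>_def)
        have "(1 + \<sigma>) powr (- p) = (1 / (1 + \<sigma>)) powr p"
          using \<sigma> by (simp add: powr_minus powr_divide field_simps)
        also have "\<dots> \<le> 1 + p * (1 / (1 + \<sigma>) - 1)"
          using \<sigma> assms by (intro powr_le_tangent_at_1) auto
        also have "\<dots> = 1 - p * (\<sigma> / (1 + \<sigma>))" using \<sigma> by (simp add: field_simps)
        \<comment> \<open>\<open>1 + \<sigma> < 3\<close> is the origin of the 3 in
          \<open>K\<close>.\<close>
        also have "\<dots> \<le> 1 - p * (\<sigma> / 3)"
          using \<sigma> \<open>\<sigma> < 2\<close> assms by (intro diff_left_mono mult_left_mono divide_left_mono) auto
        finally have "s powr (- p) * (1 + \<sigma>) powr (- p) \<le> s powr (- p) * (1 - p * (\<sigma> / 3))"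
          using sp by (intro mult_left_mono) auto
        also have "\<dots> = s powr (- p) - p * r / 3"
          using 3 by (simp add: \<sigma>_def powr_minus field_simps)
        finally have "p * r / 3 \<le> s powr (- p) - t powr (- p)" using pw by linarith
        from mult_left_mono[OF this, of K] have "1 \<le> K * (s powr (- p) - t powr (- p))"
          using K assms by (simp add: K_def)
        then have "1 \<le> K * (1 - t powr (- p)) - K * (1 - s powr (- p))"
          by (simp add: algebra_simps)
        moreover have "\<Phi> s = 1 / r + (1 + K * (1 - s powr (- p))) + ln (max 1 (s / \<theta>))"
          "\<Phi> t = 1 / r + (1 + K * (1 - t powr (- p))) + ln (max 1 (t / \<theta>))"
          using 3 \<open>t > 1\<close> by (auto simp: \<Phi>_def)
        ultimately show ?thesis using ln_mono by linarith
      qed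
    qed
  qed
  have "real j + \<Phi> (x j) \<le> \<Phi> (x 0)" if "j \<le> N" for j
    using that
  proof (induction j)
    case (Suc j)
    then have "\<Phi> (x (Suc j)) + 1 \<le> \<Phi> (x j)"
      using nonneg[of "Suc j"] step[of j] by (intro \<Phi>_step) auto
    then show ?case using Suc by simp
  qed simp
  from this[of N] have "real N \<le> \<Phi> (x 0)" using \<Phi>_nonneg[OF nonneg, of N] by simp
  also have "\<Phi> (x 0) \<le> 1 / r + (1 + K) + ln B"
    unfolding \<Phi>_def
  proof (intro add_mono)
    show "min (x 0) 1 / r \<le> 1 / r" using assms by (intro divide_right_mono) auto
    show "(if 1 < x 0 then 1 + K * (1 - x 0 powr - p) else 0) \<le> 1 + K"
      using K by (simp add: algebra_simps)
    \<comment> \<open>Below \<open>\<theta>\<close> the logarithmic part vanishes; from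
      \<open>\<theta>\<close> on \<open>init\<close> applies.\<close>
    have "max 1 (x 0 / \<theta>) \<le> B"
    proof (cases "\<theta> \<le> x 0")
      case True
      then have "x 0 \<le> B" using \<theta>_iff[of "x 0"] nonneg[of 0] init by auto
      moreover have "x 0 / \<theta> \<le> x 0" using \<theta> nonneg[of 0] by (simp add: divide_le_eq mult_le_cancel_left1)
      ultimately show ?thesis using \<open>1 \<le> B\<close> by simp
    next
      case False
      then have "x 0 / \<theta> \<le> 1" using \<theta> by simp
      then show ?thesis using \<open>1 \<le> B\<close> by simp
    qed
    then show "ln (max 1 (x 0 / \<theta>)) \<le> ln B" by (intro ln_mono) auto
  qed
  \<comment> \<open>Together with \<open>K = 3 / (p * r)\<close> this makes up
    \<open>4 / (p * r)\<close>.\<close>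
  also have "1 / r \<le> 1 / (p * r)"
    using assms by (intro divide_left_mono) (auto simp: mult_left_le_one_le)
  finally show ?thesis by (simp add: K_def)
qed

text \<open>To be applied to the optimality gaps with \<open>R = \<rho> * D\<^sup>2\<close>:
  \<open>N1\<close> counts a linearly convergent phase down to the level \<open>R\<close>,
  \<open>N2\<close> a sublinear one from there down to \<open>\<epsilon>\<close>.\<close>

lemma outer_step_count:
  fixes \<delta> :: "nat \<Rightarrow> real" and R \<beta> \<epsilon> :: real
  defines "N1 \<equiv> nat \<lceil>log_plus (\<delta> 0 / R) / ln (1 / (1 - \<beta> / 2))\<rceil>"
    and "N2 \<equiv> nat \<lceil>2 * R / (\<beta> * \<epsilon>)\<rceil>"
  assumes "0 < R" "0 < \<beta>" "\<beta> < 1" "0 < \<epsilon>"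
    and pos: "\<And>i. i \<le> K \<Longrightarrow> \<epsilon> < \<delta> i"
    and step: "\<And>i t. i < K \<Longrightarrow> 0 \<le> t \<Longrightarrow> t \<le> 1 \<Longrightarrow>
       \<delta> (Suc i) \<le> \<delta> i - \<beta> * (t * \<delta> i - R / 2 * t\<^sup>2)"
  shows "K < N1 + N2"
proof (rule ccontr)
  assume "\<not> K < N1 + N2"
  then have K: "N1 + N2 \<le> K" by simp
  have \<delta>_pos: "0 < \<delta> i" if "i \<le> K" for i
    using pos[OF that] \<open>0 < \<epsilon>\<close> by linarith
  have decr: "\<delta> (i + j) \<le> \<delta> i" if "i + j \<le> K" for i j
    using that
  proof (induction j)
    case (Suc j)
    then show ?case using step[of "i + j" 0] by simp
  qed simp
  (* While R < \<delta> take t = 1: the gap contracts by 1 - \<beta>/2. Afterwards t = \<delta>/R: the reciprocal of the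
     gap grows by \<beta>/(2R). *)
  have "\<exists>i\<le>N1. \<delta> i \<le> R"
  proof (rule ccontr)
    assume *: "\<not> ?thesis"
    define \<gamma> where "\<gamma> = 1 - \<beta> / 2"
    have \<gamma>: "0 < \<gamma>" "\<gamma> < 1" using assms by (auto simp: \<gamma>_def)
    have "\<delta> i \<le> \<gamma> ^ i * \<delta> 0" if "i \<le> N1" for i
      using that
    proof (induction i)
      case (Suc i)
      have "\<delta> (Suc i) \<le> \<delta> i - \<beta> * (\<delta> i - R / 2)" using step[of i 1] Suc K by simp
      also have "\<dots> \<le> \<delta> i - \<beta> * (\<delta> i / 2)"
        using * Suc.prems \<open>0 < \<beta>\<close> by (intro diff_left_mono mult_left_mono) (auto simp: not_le field_simps dest!: spec[of _ i])
      also have "\<dots> = \<gamma> * \<delta> i" by (simp add: \<gamma>_def algebra_simps)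
      also have "\<dots> \<le> \<gamma> * (\<gamma> ^ i * \<delta> 0)" using Suc \<gamma> by (intro mult_left_mono) auto
      finally show ?case by (simp add: mult_ac)
    qed simp
    then have "\<delta> N1 \<le> \<gamma> ^ N1 * \<delta> 0" by simp
    then have lt: "R < \<gamma> ^ N1 * \<delta> 0" using * by (auto simp: not_le intro: less_le_trans)
    have \<delta>0: "0 < \<delta> 0" using \<delta>_pos[of 0] by simp
    have "ln R < ln (\<gamma> ^ N1 * \<delta> 0)" using lt \<open>0 < R\<close> by (intro ln_less_cancel_iff[THEN iffD2]) auto
    also have "\<dots> = N1 * ln \<gamma> + ln (\<delta> 0)"
      using \<gamma> \<delta>0 by (simp add: ln_mult_pos ln_realpow)
    finally have "N1 * (- ln \<gamma>) < ln (\<delta> 0 / R)" using \<delta>0 \<open>0 < R\<close> by (simp add: ln_div)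
    also have "\<dots> \<le> log_plus (\<delta> 0 / R)" by (simp add: log_plus_def)
    finally have "real N1 < log_plus (\<delta> 0 / R) / (- ln \<gamma>)"
      using \<gamma> by (subst pos_less_divide_eq) auto
    moreover have "ln (1 / (1 - \<beta> / 2)) = - ln \<gamma>" using \<gamma> by (simp add: \<gamma>_def ln_div)
    ultimately have "real N1 < log_plus (\<delta> 0 / R) / ln (1 / (1 - \<beta> / 2))" by simp
    then show False unfolding N1_def by linarith
  qed
  then obtain i where "i \<le> N1" "\<delta> i \<le> R" by blast
  then have start: "\<delta> N1 \<le> R" using decr[of i "N1 - i"] K by simp
  have inv: "1 / \<delta> N1 + j * (\<beta> / (2 * R)) \<le> 1 / \<delta> (N1 + j)" if "j \<le> N2" for j
    using that
  proof (induction j)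
    case (Suc j)
    define a where "a = \<delta> (N1 + j)"
    define u where "u = \<beta> * a / (2 * R)"
    have a: "0 < a" "a \<le> R" using \<delta>_pos[of "N1 + j"] decr[of N1 j] start Suc.prems K by (auto simp: a_def)
    have "\<delta> (Suc (N1 + j)) \<le> a - \<beta> * ((a / R) * a - R / 2 * (a / R)\<^sup>2)"
      unfolding a_def using Suc.prems K a \<open>0 < R\<close> by (intro step) (auto simp: a_def)
    also have "\<dots> = a * (1 - u)" using \<open>0 < R\<close> by (simp add: u_def field_simps power2_eq_square)
    finally have le: "\<delta> (Suc (N1 + j)) \<le> a * (1 - u)" .
    have b: "0 < \<delta> (Suc (N1 + j))" using \<delta>_pos[of "Suc (N1 + j)"] Suc.prems K by simp
    \<comment> \<open>\<open>(1 + u) * (1 - u) \<le> 1\<close> turns the factor \<open>1 - u\<close>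
      for the gap into a factor \<open>1 + u\<close> for its reciprocal.\<close>
    have "(1 + u) * \<delta> (Suc (N1 + j)) \<le> (1 + u) * (a * (1 - u))"
      using le a assms by (intro mult_left_mono) (auto simp: u_def)
    also have "\<dots> = a * (1 - u\<^sup>2)" by (simp add: algebra_simps power2_eq_square)
    also have "\<dots> \<le> a" using a by (simp add: mult_left_le)
    finally have "(1 + u) / a \<le> 1 / \<delta> (Suc (N1 + j))" using a b by (simp add: field_simps)
    moreover have "(1 + u) / a = 1 / a + \<beta> / (2 * R)" using a by (simp add: u_def field_simps)
    ultimately show ?case using Suc by (simp add: a_def algebra_simps add_divide_distrib)
  qed simp
  have "2 * R / (\<beta> * \<epsilon>) \<le> N2" unfolding N2_def by linarith
  then have "2 * R / (\<beta> * \<epsilon>) * (\<beta> / (2 * R)) \<le> N2 * (\<beta> / (2 * R))"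
    using \<open>0 < R\<close> \<open>0 < \<beta>\<close> by (intro mult_right_mono) auto
  then have "1 / \<epsilon> \<le> N2 * (\<beta> / (2 * R))" using \<open>0 < R\<close> \<open>0 < \<beta>\<close> by simp
  \<comment> \<open>The positive starting value \<open>1 / \<delta> N1\<close> makes this strict, so
    \<open>\<delta> (N1 + N2) < \<epsilon>\<close>.\<close>
  also have "\<dots> < 1 / \<delta> (N1 + N2)"
  proof -
    have "0 < 1 / \<delta> N1" using \<delta>_pos[of N1] K by simp
    then show ?thesis using inv[of N2] by linarith
  qed
  finally show False using pos[of "N1 + N2"] \<delta>_pos[of "N1 + N2"] K \<open>0 < \<epsilon>\<close> by (simp add: field_simps)
qed

section \<open>The Moreau envelope of a composite objective\<close>

locale composite =
  fixes f :: "'a::euclidean_space \<Rightarrow> real" and h :: "'a \<Rightarrow> ereal" and \<rho> :: real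
  assumes f_convex: "convex_on UNIV f"
    and h_proper: "proper_fun h"
    and h_convex: "convex_fun h"
    and minimizers_nonempty: "minimizers (objective f h) \<noteq> {}"
    and \<rho>_pos: "0 < \<rho>"
begin

definition edom :: "'a set" where
  "edom = {x. h x < \<infinity>}"

text \<open>Faithful to \<open>h\<close> on \<open>edom\<close> only: elsewhere \<open>h\<close> is
  infinite and \<open>hr\<close> is 0.\<close>

definition hr :: "'a \<Rightarrow> real" where
  "hr x = real_of_ereal (h x)"

definition F :: "'a \<Rightarrow> real" where
  "F x = f x + hr x"

definition Fmin :: real where
  "Fmin = real_of_ereal (min_value (objective f h))"

text \<open>A real infimum over the points where \<open>F\<close> is finite, meaningful because
  \<open>Fmin\<close> bounds it from below.\<close>

definition moreau :: "'a \<Rightarrow> real" where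
  "moreau y = (INF x\<in>edom. F x + \<rho> / 2 * (norm (x - y))\<^sup>2)"

definition gain :: "'a \<Rightarrow> real" where
  "gain y = F y - moreau y"

lemma h_eq: "x \<in> edom \<Longrightarrow> h x = ereal (hr x)"
  using h_proper by (cases "h x") (auto simp: edom_def hr_def proper_fun_def)

lemma objective_eq: "x \<in> edom \<Longrightarrow> objective \<phi> h x = ereal (\<phi> x + hr x)"
  by (simp add: objective_def h_eq)

lemma objective_outside: "x \<notin> edom \<Longrightarrow> objective \<phi> h x = \<infinity>"
  by (simp add: objective_def edom_def)

lemma objective_finite_iff: "objective \<phi> h x < \<infinity> \<longleftrightarrow> x \<in> edom"
  using objective_eq[of x \<phi>] objective_outside[of x \<phi>] by (cases "x \<in> edom") auto

lemma hr_convex: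
  assumes "x \<in> edom" "y \<in> edom" "0 \<le> t" "t \<le> 1"
  shows "(1 - t) *\<^sub>R x + t *\<^sub>R y \<in> edom"
    and "hr ((1 - t) *\<^sub>R x + t *\<^sub>R y) \<le> (1 - t) * hr x + t * hr y"
proof -
  have "(1 - t) *\<^sub>R x + t *\<^sub>R y \<in> edom \<and>
    hr ((1 - t) *\<^sub>R x + t *\<^sub>R y) \<le> (1 - t) * hr x + t * hr y"
  proof (cases "t \<in> {0<..<1}")
    case True
    then have "h ((1 - t) *\<^sub>R x + t *\<^sub>R y) \<le> ereal (1 - t) * h x + ereal t * h y"
      using h_convex by (simp add: convex_fun_def)
    also have "\<dots> = ereal ((1 - t) * hr x + t * hr y)" using assms by (simp add: h_eq)
    finally have le: "h ((1 - t) *\<^sub>R x + t *\<^sub>R y) \<le> ereal ((1 - t) * hr x + t * hr y)" .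
    also have "\<dots> < \<infinity>" by simp
    finally have e: "(1 - t) *\<^sub>R x + t *\<^sub>R y \<in> edom" by (simp add: edom_def)
    with le show ?thesis by (simp add: h_eq)
  next
    case False
    then have "t = 0 \<or> t = 1" using assms by auto
    then show ?thesis using assms by auto
  qed
  then show "(1 - t) *\<^sub>R x + t *\<^sub>R y \<in> edom"
    and "hr ((1 - t) *\<^sub>R x + t *\<^sub>R y) \<le> (1 - t) * hr x + t * hr y" by auto
qed

lemma edom_nonempty: "edom \<noteq> {}"
  using h_proper by (auto simp: proper_fun_def edom_def)

lemma minimizer_edom:
  assumes "x \<in> minimizers (objective f h)"
  shows "x \<in> edom" "F x = Fmin" "min_value (objective f h) = ereal Fmin"
proof -
  obtain x0 where x0: "x0 \<in> edom" using edom_nonempty by auto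
  have "objective f h x = min_value (objective f h)"
    using assms by (simp add: minimizers_def)
  also have "\<dots> \<le> objective f h x0"
    by (simp add: min_value_def INF_lower)
  also have "\<dots> < \<infinity>" using x0 by (simp add: objective_eq)
  finally have "objective f h x < \<infinity>" .
  then show "x \<in> edom" by (rule iffD1[OF objective_finite_iff])
  then have eq: "min_value (objective f h) = ereal (F x)"
    using assms by (simp add: minimizers_def objective_eq F_def)
  then show "F x = Fmin" by (simp add: Fmin_def)
  with eq show "min_value (objective f h) = ereal Fmin" by simp
qed

lemma min_value_eq: "min_value (objective f h) = ereal Fmin"
  using minimizers_nonempty minimizer_edom(3) by blast

lemma Fmin_le: "x \<in> edom \<Longrightarrow> Fmin \<le> F x"
proof -
  assume "x \<in> edom"
  have "min_value (objective f h) \<le> objective f h x"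
    by (simp add: min_value_def INF_lower)
  then show ?thesis using \<open>x \<in> edom\<close> by (simp add: min_value_eq objective_eq F_def)
qed

lemma moreau_le: "x \<in> edom \<Longrightarrow> moreau y \<le> F x + \<rho> / 2 * (norm (x - y))\<^sup>2"
  unfolding moreau_def
proof (rule cINF_lower)
  show "bdd_below ((\<lambda>x. F x + \<rho> / 2 * (norm (x - y))\<^sup>2) ` edom)"
    using Fmin_le \<rho>_pos by (intro bdd_belowI2[of _ Fmin]) (simp add: add_increasing2)
qed

lemma moreau_ge: "(\<And>x. x \<in> edom \<Longrightarrow> c \<le> F x + \<rho> / 2 * (norm (x - y))\<^sup>2) \<Longrightarrow> c \<le> moreau y"
  unfolding moreau_def using edom_nonempty by (intro cINF_greatest) auto

lemma gain_ge:
  assumes y: "y \<in> edom" and D: "infdist y (minimizers (objective f h)) \<le> D"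
    and t: "0 \<le> t" "t \<le> 1"
  shows "t * (F y - Fmin) - \<rho> * D\<^sup>2 / 2 * t\<^sup>2 \<le> gain y"
proof -
  \<comment> \<open>\<open>infdist\<close> is an infimum, so a minimizer is picked only within
    \<open>D + e\<close>; the slack \<open>e\<close> tends to 0 at the end.\<close>
  have near: "t * (F y - Fmin) - \<rho> * (D + e)\<^sup>2 / 2 * t\<^sup>2 \<le> gain y" if "e > 0" for e
  proof -
    have "infdist y (minimizers (objective f h)) < D + e" using D \<open>e > 0\<close> by simp
    then obtain x where x: "x \<in> minimizers (objective f h)" "dist y x < D + e"
      using minimizers_nonempty by (auto simp: infdist_notempty cInf_less_iff)
    let ?p = "(1 - t) *\<^sub>R y + t *\<^sub>R x"
    have xe: "x \<in> edom" "F x = Fmin" using minimizer_edom x by auto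
    have "f ?p \<le> (1 - t) * f y + t * f x"
      using f_convex t by (intro convex_onD) auto
    moreover have "hr ?p \<le> (1 - t) * hr y + t * hr x"
      using y xe t by (intro hr_convex)
    moreover have "moreau y \<le> F ?p + \<rho> / 2 * (norm (?p - y))\<^sup>2"
      using y xe t by (intro moreau_le hr_convex)
    moreover have "?p - y = t *\<^sub>R (x - y)" by (simp add: algebra_simps)
    then have "(norm (?p - y))\<^sup>2 = t\<^sup>2 * (dist y x)\<^sup>2"
      by (simp add: power_mult_distrib dist_norm norm_minus_commute)
    ultimately have "moreau y \<le> ((1 - t) * f y + t * f x) + ((1 - t) * hr y + t * hr x)
        + \<rho> / 2 * (t\<^sup>2 * (dist y x)\<^sup>2)"
      by (simp only: F_def)
    moreover have "\<rho> / 2 * (t\<^sup>2 * (dist y x)\<^sup>2) \<le> \<rho> / 2 * (t\<^sup>2 * (D + e)\<^sup>2)"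
      using x(2) \<rho>_pos by (intro mult_left_mono power_mono) auto
    ultimately have "moreau y \<le> ((1 - t) * f y + t * f x) + ((1 - t) * hr y + t * hr x)
        + \<rho> / 2 * (t\<^sup>2 * (D + e)\<^sup>2)"
      by linarith
    also have "\<dots> = (1 - t) * F y + t * Fmin + \<rho> / 2 * (t\<^sup>2 * (D + e)\<^sup>2)"
      by (simp add: F_def algebra_simps flip: xe(2))
    finally have "moreau y \<le> (1 - t) * F y + t * Fmin + \<rho> / 2 * (t\<^sup>2 * (D + e)\<^sup>2)" .
    then show ?thesis by (simp add: gain_def algebra_simps)
  qed
  have "((\<lambda>e. t * (F y - Fmin) - \<rho> * (D + e)\<^sup>2 / 2 * t\<^sup>2) \<longlongrightarrow>
      t * (F y - Fmin) - \<rho> * (D + 0)\<^sup>2 / 2 * t\<^sup>2) (at_right 0)"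
    by (intro tendsto_intros) simp_all
  then have "t * (F y - Fmin) - \<rho> * (D + 0)\<^sup>2 / 2 * t\<^sup>2 \<le> gain y"
  proof (rule tendsto_upperbound)
    show "\<forall>\<^sub>F e in at_right 0. t * (F y - Fmin) - \<rho> * (D + e)\<^sup>2 / 2 * t\<^sup>2 \<le> gain y"
      by (rule eventually_mono[OF eventually_at_right_less]) (rule near)
  qed simp
  then show ?thesis by simp
qed

text \<open>Lowering the gap to \<open>\<epsilon>\<close> and raising
  \<open>\<rho> * D\<^sup>2\<close> to \<open>X = max (\<rho> * D\<^sup>2) \<epsilon>\<close> only
  weakens \<open>gain_ge\<close>. Then \<open>t = \<epsilon> / X\<close> maximizes
  \<open>t * \<epsilon> - X / 2 * t\<^sup>2\<close>, and \<open>X \<ge> \<epsilon>\<close> keeps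
  \<open>t \<le> 1\<close>.\<close>

lemma gain_pos:
  assumes "y \<in> edom" "infdist y (minimizers (objective f h)) \<le> D" "0 < D"
    and "0 < \<epsilon>" "\<epsilon> < F y - Fmin"
  shows "\<epsilon>\<^sup>2 / (2 * max (\<rho> * D\<^sup>2) \<epsilon>) \<le> gain y"
proof -
  define \<delta> where "\<delta> = F y - Fmin"
  define R where "R = \<rho> * D\<^sup>2"
  have pos: "0 < R" "0 < \<delta>" "\<epsilon> < \<delta>" using assms \<rho>_pos by (auto simp: R_def \<delta>_def)
  define t where "t = \<epsilon> / max R \<epsilon>"
  have t: "0 \<le> t" "t \<le> 1" using assms by (auto simp: t_def)
  have "t * \<epsilon> - max R \<epsilon> / 2 * t\<^sup>2 \<le> t * \<delta> - R / 2 * t\<^sup>2"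
    using pos t by (intro diff_mono mult_left_mono mult_right_mono) auto
  also have "\<dots> \<le> gain y" using gain_ge[OF assms(1,2) t] by (simp add: \<delta>_def R_def)
  also have "t * \<epsilon> - max R \<epsilon> / 2 * t\<^sup>2 = \<epsilon>\<^sup>2 / (2 * max R \<epsilon>)"
  proof -
    have "\<epsilon> / X * \<epsilon> - X / 2 * (\<epsilon> / X)\<^sup>2 = \<epsilon>\<^sup>2 / (2 * X)" if "0 < X" for X :: real
      using that by (simp add: power2_eq_square)
    then show ?thesis unfolding t_def using pos by simp
  qed
  finally show ?thesis by (simp add: R_def)
qed

end

section \<open>Null steps\<close>

text \<open>An inner run whose first \<open>n\<close> tests failed. Iteration \<open>n\<close> has
  then been started, so model \<open>n\<close> is admissible too.\<close>

locale null_steps = composite f h \<rho>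
  for f :: "'a::euclidean_space \<Rightarrow> real" and h :: "'a \<Rightarrow> ereal" and \<rho> :: real +
  fixes \<nu> L \<beta> :: real and y :: 'a and z :: "nat \<Rightarrow> 'a" and m :: "nat \<Rightarrow> 'a \<Rightarrow> real" and n :: nat
  assumes \<nu>: "0 \<le> \<nu>" "\<nu> \<le> 1" and L: "0 < L" and hoelder: "hoelder_smooth f \<nu> L"
    and \<beta>: "0 < \<beta>" "\<beta> < 1"
    and y: "y \<in> edom" and z0: "z 0 = y"
    and adm: "\<And>j. j \<le> n \<Longrightarrow> admissible_model f h \<rho> y z m j"
    and fail: "\<And>j. j < n \<Longrightarrow> \<not> descent_test f h \<beta> y (m j) (z (Suc j))"
begin

definition d :: "nat \<Rightarrow> real" where
  "d j = norm (z (Suc j) - z j)"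

definition prox_value :: "nat \<Rightarrow> real" where
  "prox_value j = m j (z (Suc j)) + hr (z (Suc j)) + \<rho> / 2 * (norm (z (Suc j) - y))\<^sup>2"

definition w :: "nat \<Rightarrow> real" where
  "w j = moreau y - prox_value j"

definition e :: "nat \<Rightarrow> real" where
  "e j = f (z (Suc j)) - m j (z (Suc j))"

lemma model_le: "j \<le> n \<Longrightarrow> m j x \<le> f x"
  using adm by (auto simp: admissible_model_def)

text \<open>The subgradients certifying that \<open>z (Suc j)\<close> solves subproblem
  \<open>j\<close> come with the admissibility of the next model \<open>m (Suc j)\<close>.\<close>

lemma aggregate:
  assumes "j < n"
  obtains a b where "z (Suc j) \<in> edom"
    "\<And>x. m j (z (Suc j)) + a \<bullet> (x - z (Suc j)) \<le> m j x"
    "\<And>x. m j (z (Suc j)) + a \<bullet> (x - z (Suc j)) \<le> m (Suc j) x"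
    "\<And>x. x \<in> edom \<Longrightarrow> hr (z (Suc j)) + b \<bullet> (x - z (Suc j)) \<le> hr x"
    "a + b = \<rho> *\<^sub>R (y - z (Suc j))"
proof -
  from adm[of "Suc j"] assms obtain a b where
    ab: "a \<in> subdiff_real (m j) (z (Suc j))" "b \<in> subdifferential h (z (Suc j))"
    "a + b = \<rho> *\<^sub>R (y - z (Suc j))" "\<forall>x. m (Suc j) x \<ge> m j (z (Suc j)) + a \<bullet> (x - z (Suc j))"
    unfolding admissible_model_def by auto
  have ze: "z (Suc j) \<in> edom"
    using ab(2) by (auto simp: subdifferential_def edom_def)
  have "hr (z (Suc j)) + b \<bullet> (x - z (Suc j)) \<le> hr x" if "x \<in> edom" for x
    using ab(2) ze that by (auto simp: subdifferential_def h_eq dest!: spec[of _ x])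
  then show ?thesis using that[OF ze] ab by (auto simp: mem_subdiff_real_iff)
qed

lemma z_edom: "j < n \<Longrightarrow> z (Suc j) \<in> edom"
  using aggregate by blast

text \<open>Three-point identity: \<open>x - c\<close> expanded around \<open>u\<close>.\<close>

lemma quadratic_identity:
  "\<rho> / 2 * (norm (u - c))\<^sup>2 + \<rho> / 2 * (norm (x - u))\<^sup>2
   = (\<rho> *\<^sub>R (c - u)) \<bullet> (x - u) + \<rho> / 2 * (norm (x - c))\<^sup>2" for u c x :: 'a
  by (simp add: power2_norm_eq_inner algebra_simps inner_commute)

text \<open>The aggregate linearization transfers the quadratic growth of the proximal subproblem around its
  solution to the next model.\<close>

lemma prox_growth:
  assumes "j < n" "x \<in> edom"
  shows "prox_value j + \<rho> / 2 * (norm (x - z (Suc j)))\<^sup>2 \<le> m j x + hr x + \<rho> / 2 * (norm (x - y))\<^sup>2"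
    and "prox_value j + \<rho> / 2 * (norm (x - z (Suc j)))\<^sup>2 \<le> m (Suc j) x + hr x + \<rho> / 2 * (norm (x - y))\<^sup>2"
proof -
  obtain a b where ab:
    "\<And>x. m j (z (Suc j)) + a \<bullet> (x - z (Suc j)) \<le> m j x"
    "\<And>x. m j (z (Suc j)) + a \<bullet> (x - z (Suc j)) \<le> m (Suc j) x"
    "\<And>x. x \<in> edom \<Longrightarrow> hr (z (Suc j)) + b \<bullet> (x - z (Suc j)) \<le> hr x"
    "a + b = \<rho> *\<^sub>R (y - z (Suc j))"
    using aggregate[OF assms(1)] by metis
  have "(\<rho> *\<^sub>R (y - z (Suc j))) \<bullet> (x - z (Suc j)) = a \<bullet> (x - z (Suc j)) + b \<bullet> (x - z (Suc j))"
    by (simp add: ab(4)[symmetric] inner_add_left)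
  note * = quadratic_identity[of "z (Suc j)" y x] this ab(3)[OF assms(2)]
  show "prox_value j + \<rho> / 2 * (norm (x - z (Suc j)))\<^sup>2 \<le> m j x + hr x + \<rho> / 2 * (norm (x - y))\<^sup>2"
    using * ab(1)[of x] unfolding prox_value_def by linarith
  show "prox_value j + \<rho> / 2 * (norm (x - z (Suc j)))\<^sup>2 \<le> m (Suc j) x + hr x + \<rho> / 2 * (norm (x - y))\<^sup>2"
    using * ab(2)[of x] unfolding prox_value_def by linarith
qed

lemma w_nonneg:
  assumes "j < n" shows "0 \<le> w j"
proof -
  have "prox_value j \<le> F x + \<rho> / 2 * (norm (x - y))\<^sup>2" if "x \<in> edom" for x
  proof -
    have "0 \<le> \<rho> / 2 * (norm (x - z (Suc j)))\<^sup>2" using \<rho>_pos by simp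
    then show ?thesis using prox_growth(1)[OF assms that] model_le[of j x] assms by (simp add: F_def)
  qed
  then show ?thesis unfolding w_def using moreau_ge by fastforce
qed

text \<open>Test the envelope at \<open>z (Suc j)\<close>: the proximal terms cancel and the model
  error remains.\<close>

lemma w_le_e: "j < n \<Longrightarrow> w j \<le> e j"
  using moreau_le[OF z_edom, of j y] by (simp add: w_def e_def prox_value_def F_def)

lemma w_step:
  assumes "Suc j < n" shows "w (Suc j) + \<rho> / 2 * (d (Suc j))\<^sup>2 \<le> w j"
  using prox_growth(2)[of j "z (Suc (Suc j))"] z_edom[of "Suc j"] assms
  by (simp add: w_def d_def prox_value_def)

text \<open>The model lies above a linearization of \<open>f\<close> at \<open>z j\<close>, so its
  error is at most the linearization error.\<close>

lemma e_le: "j < n \<Longrightarrow> e j \<le> L / (1 + \<nu>) * d j powr (1 + \<nu>)"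
proof -
  assume "j < n"
  then obtain g where g: "g \<in> subdiff_real f (z j)" "\<And>x. f (z j) + g \<bullet> (x - z j) \<le> m j x"
    using adm[of j] by (auto simp: admissible_model_def)
  show ?thesis
    using hoelder_descent[OF f_convex hoelder \<nu>(1) L g(1), of "z (Suc j)"] g(2)[of "z (Suc j)"]
    by (simp add: e_def d_def)
qed

lemma e_gt:
  assumes "j < n" shows "(1 - \<beta>) * gain y < e j"
proof -
  have ze: "z (Suc j) \<in> edom" using assms by (rule z_edom)
  have "F y - F (z (Suc j)) < \<beta> * (F y - (m j (z (Suc j)) + hr (z (Suc j))))"
    using fail[OF assms] y ze by (simp add: descent_test_def objective_eq F_def not_le)
  \<comment> \<open>\<open>X\<close> is the decrease predicted by the model and
    \<open>X - e j\<close> the actual one; the prediction is at least \<open>gain y\<close>.\<close>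
  moreover define X where "X = F y - (m j (z (Suc j)) + hr (z (Suc j)))"
  moreover have "F (z (Suc j)) = m j (z (Suc j)) + hr (z (Suc j)) + e j"
    by (simp add: F_def e_def)
  ultimately have "X - e j < \<beta> * X" by simp
  moreover have "X = gain y + w j + \<rho> / 2 * (norm (z (Suc j) - y))\<^sup>2"
    by (simp add: X_def gain_def w_def prox_value_def)
  then have "gain y \<le> X" using w_nonneg[OF assms] \<rho>_pos by simp
  then have "(1 - \<beta>) * gain y \<le> (1 - \<beta>) * X" using \<beta> by (intro mult_left_mono) auto
  ultimately show ?thesis by (simp add: left_diff_distrib)
qed

text \<open>As \<open>z 0 = y\<close>, the growth term of subproblem 0 at the centre is the first
  step length \<open>d 0\<close>.\<close>

lemma d0_le: "0 < n \<Longrightarrow> \<rho> / 2 * (d 0)\<^sup>2 \<le> gain y + w 0"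
  using prox_growth(1)[of 0 y] y z0 model_le[of 0 y]
  by (simp add: gain_def w_def F_def d_def norm_minus_commute)

text \<open>Test the Moreau envelope at the point that lies at the fraction \<open>\<rho> / (L + \<rho>)\<close> of the way from
  \<open>y\<close> to \<open>z 1\<close>.\<close>

lemma w0_le_smooth:
  assumes "0 < n" "\<nu> = 1" shows "w 0 \<le> L / \<rho> * gain y"
proof -
  obtain g where g: "g \<in> subdiff_real f y" "\<And>x. f y + g \<bullet> (x - y) \<le> m 0 x"
    using adm[of 0] z0 by (auto simp: admissible_model_def)
  define t where "t = \<rho> / (L + \<rho>)"
  have t: "0 \<le> t" "t \<le> 1" and t': "(L + \<rho>) * t = \<rho>" using L \<rho>_pos by (auto simp: t_def)
  define u where "u = z (Suc 0)"
  let ?p = "(1 - t) *\<^sub>R y + t *\<^sub>R u"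
  define S where "S = m 0 u + hr u"
  have u: "u \<in> edom" using z_edom[of 0] assms by (simp add: u_def)
  have py: "?p - y = t *\<^sub>R (u - y)" by (simp add: algebra_simps)
  have d0: "d 0 = norm (u - y)" by (simp add: d_def z0 u_def)
  have dist: "(norm (?p - y))\<^sup>2 = t\<^sup>2 * (d 0)\<^sup>2" by (simp add: py d0 power_mult_distrib)
  have "f ?p \<le> f y + g \<bullet> (?p - y) + L / (1 + \<nu>) * norm (?p - y) powr (1 + \<nu>)"
    by (rule hoelder_descent[OF f_convex hoelder \<nu>(1) L g(1)])
  also have "L / (1 + \<nu>) * norm (?p - y) powr (1 + \<nu>) = L / 2 * (t\<^sup>2 * (d 0)\<^sup>2)"
    by (simp add: assms(2) flip: dist)
  also have "g \<bullet> (?p - y) = t * (g \<bullet> (u - y))" by (simp add: py)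
  finally have "f ?p \<le> f y + t * (g \<bullet> (u - y)) + L / 2 * (t\<^sup>2 * (d 0)\<^sup>2)" .
  moreover have "t * (f y + g \<bullet> (u - y)) \<le> t * m 0 u"
    using g(2) t by (intro mult_left_mono)
  then have "t * f y + t * (g \<bullet> (u - y)) \<le> t * m 0 u" by (simp only: distrib_left)
  moreover have "hr ?p \<le> (1 - t) * hr y + t * hr u" using y u t by (intro hr_convex)
  moreover have "moreau y \<le> F ?p + \<rho> / 2 * (norm (?p - y))\<^sup>2"
    using y u t by (intro moreau_le hr_convex)
  then have "moreau y \<le> f ?p + hr ?p + \<rho> / 2 * (t\<^sup>2 * (d 0)\<^sup>2)"
    by (simp only: dist F_def)
  ultimately have "moreau y \<le> f y - t * f y + t * m 0 u + ((1 - t) * hr y + t * hr u)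
      + L / 2 * (t\<^sup>2 * (d 0)\<^sup>2) + \<rho> / 2 * (t\<^sup>2 * (d 0)\<^sup>2)"
    by linarith
  also have "\<dots> = (1 - t) * F y + t * S + (L + \<rho>) * t * (t / 2 * (d 0)\<^sup>2)"
    by (simp add: F_def S_def power2_eq_square algebra_simps)
  \<comment> \<open>The choice of \<open>t\<close> reduces the curvature \<open>L + \<rho>\<close>
    to \<open>\<rho>\<close>, so that the bracket becomes \<open>F y\<close> minus the optimal value
    of subproblem 0.\<close>
  also have "\<dots> = F y - t * (F y - S - \<rho> / 2 * (d 0)\<^sup>2)"
    unfolding t' by (simp add: algebra_simps)
  also have "F y - S - \<rho> / 2 * (d 0)\<^sup>2 = gain y + w 0"
    by (simp add: gain_def w_def prox_value_def S_def d0 u_def)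
  finally have "t * (gain y + w 0) \<le> gain y" by (simp add: gain_def)
  then have "\<rho> * (gain y + w 0) \<le> (L + \<rho>) * gain y"
    using L \<rho>_pos by (simp add: t_def field_simps)
  then show ?thesis using \<rho>_pos by (simp add: field_simps)
qed

text \<open>A failed test at \<open>Suc N\<close> forces a long step there and hence a large
  \<open>w N\<close>, although \<open>w\<close> has contracted \<open>N\<close> times by then. The
  additive 1 is this shift of the index.\<close>

lemma null_step_bound_smooth:
  assumes "\<nu> = 1" and v: "0 < gain y"
  shows "real n \<le> 1 + real_of_int \<lceil>log_plus (L\<^sup>2 / ((1 - \<beta>) * \<rho>\<^sup>2)) / ln (1 + \<rho> / L)\<rceil>"
proof (rule ccontr)
  define N where "N = nat \<lceil>log_plus (L\<^sup>2 / ((1 - \<beta>) * \<rho>\<^sup>2)) / ln (1 + \<rho> / L)\<rceil>"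
  define q where "q = 1 + \<rho> / L"
  have q: "1 < q" using L \<rho>_pos by (simp add: q_def)
  have nonneg: "0 \<le> log_plus (L\<^sup>2 / ((1 - \<beta>) * \<rho>\<^sup>2)) / ln q"
    using q by (simp add: log_plus_def)
  assume "\<not> ?thesis"
  then have n: "Suc N < n" using nonneg unfolding N_def q_def by linarith
  have e_le_d: "e j \<le> L / 2 * (d j)\<^sup>2" if "j < n" for j
    using e_le[OF that] assms(1) by (simp add: d_def)
  have geom: "q ^ j * w j \<le> w 0" if "j < n" for j
    using that
  proof (induction j)
    case (Suc j)
    have "w (Suc j) \<le> L / 2 * (d (Suc j))\<^sup>2"
      using w_le_e e_le_d Suc.prems by (meson order_trans)
    then have "\<rho> / L * w (Suc j) \<le> \<rho> / 2 * (d (Suc j))\<^sup>2"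
      using L \<rho>_pos by (simp add: field_simps)
    moreover have "q * w (Suc j) = w (Suc j) + \<rho> / L * w (Suc j)"
      by (simp add: q_def distrib_right)
    ultimately have "q * w (Suc j) \<le> w j"
      using w_step[OF Suc.prems] by linarith
    then have "q ^ j * (q * w (Suc j)) \<le> q ^ j * w j" using q by (intro mult_left_mono) auto
    then show ?case using Suc by (simp add: mult_ac)
  qed simp
  have "\<rho> * ((1 - \<beta>) * gain y) < \<rho> * (L / 2 * (d (Suc N))\<^sup>2)"
    using e_gt[OF n] e_le_d[OF n] \<rho>_pos by (intro mult_strict_left_mono) auto
  also have "\<dots> = L * (\<rho> / 2 * (d (Suc N))\<^sup>2)" by simp
  also have "\<dots> \<le> L * w N"
    using w_step[OF n] w_nonneg[OF n] L by (intro mult_left_mono) auto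
  finally have "q ^ N * (\<rho> * ((1 - \<beta>) * gain y)) < q ^ N * (L * w N)"
    using q by (intro mult_strict_left_mono) auto
  also have "\<dots> \<le> L * w 0" using geom[of N] n L by (simp add: mult.left_commute)
  also have "\<dots> \<le> L * (L / \<rho> * gain y)"
    using w0_le_smooth assms(1) n L by (intro mult_left_mono) auto
  finally have "q ^ N * \<rho> * (1 - \<beta>) * gain y < L * (L / \<rho>) * gain y" by (simp add: mult_ac)
  then have "q ^ N * \<rho> * (1 - \<beta>) < L * (L / \<rho>)" using v by (simp only: mult_less_cancel_right_pos)
  then have "q ^ N < L\<^sup>2 / ((1 - \<beta>) * \<rho>\<^sup>2)"
    using \<rho>_pos \<beta> by (simp add: field_simps power2_eq_square)
  then have "ln (q ^ N) < ln (L\<^sup>2 / ((1 - \<beta>) * \<rho>\<^sup>2))"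
    using q L \<rho>_pos \<beta> by (intro ln_less_cancel_iff[THEN iffD2]) auto
  also have "\<dots> \<le> log_plus (L\<^sup>2 / ((1 - \<beta>) * \<rho>\<^sup>2))" by (simp add: log_plus_def)
  finally have "N * ln q < log_plus (L\<^sup>2 / ((1 - \<beta>) * \<rho>\<^sup>2))"
    using q by (simp add: ln_realpow)
  moreover have "log_plus (L\<^sup>2 / ((1 - \<beta>) * \<rho>\<^sup>2)) / ln q \<le> N"
    unfolding N_def q_def by (rule real_nat_ceiling_ge)
  then have "log_plus (L\<^sup>2 / ((1 - \<beta>) * \<rho>\<^sup>2)) \<le> N * ln q"
    using q by (simp add: pos_divide_le_eq)
  ultimately show False by simp
qed

text \<open>Since \<open>(1 + \<nu>) * (1 + p) = 2\<close>, inverting \<open>e_le\<close> bounds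
  \<open>(d j)\<^sup>2\<close> below by a multiple of \<open>e j powr (1 + p)\<close>. Both
  \<open>w j\<close> and \<open>(1 - \<beta>) * gain y\<close> are at most \<open>e j\<close>, which
  yields the \<open>max\<close> in \<open>null_step_count\<close>.\<close>

lemma null_step_bound_hoelder:
  assumes "\<nu> < 1" and v: "0 < gain y"
  shows "real n \<le> 2 + ln (1 / (1 - \<beta>)) +
     8 / (1 - \<nu>) * (L powr (2 / (1 + \<nu>)) / \<rho>) * ((1 - \<beta>) * gain y) powr (- ((1 - \<nu>) / (1 + \<nu>)))"
proof (cases "n = 0")
  case True
  have "0 \<le> ln (1 / (1 - \<beta>))" using \<beta> by simp
  then show ?thesis using True assms \<rho>_pos by simp
next
  case False
  define p where "p = (1 - \<nu>) / (1 + \<nu>)"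
  define A where "A = L / (1 + \<nu>)"
  define \<alpha> where "\<alpha> = (1 - \<beta>) * gain y"
  define c where "c = \<rho> / 2 * A powr (- (1 + p))"
  have p: "0 < p" "p \<le> 1" using \<nu> assms by (auto simp: p_def)
  have p1: "(1 + \<nu>) * (1 + p) = 2" "1 + p = 2 / (1 + \<nu>)" using \<nu> by (auto simp: p_def field_simps)
  have A: "0 < A" using L \<nu> by (simp add: A_def)
  have \<alpha>: "0 < \<alpha>" using v \<beta> by (simp add: \<alpha>_def)
  have c: "0 < c" using A \<rho>_pos by (simp add: c_def)
  have d_ge: "c * s powr (1 + p) \<le> \<rho> / 2 * (d j)\<^sup>2" if "0 \<le> s" "s \<le> e j" "j < n" for s j
  proof -
    have "s powr (1 + p) \<le> (A * d j powr (1 + \<nu>)) powr (1 + p)"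
      using that e_le[of j] p by (intro powr_mono2) (auto simp: A_def)
    also have "\<dots> = A powr (1 + p) * d j powr 2"
      using A by (simp add: powr_mult powr_powr p1(1))
    finally have "c * s powr (1 + p) \<le> c * (A powr (1 + p) * (d j)\<^sup>2)"
      using c by (intro mult_left_mono) (auto simp: d_def)
    also have "\<dots> = \<rho> / 2 * (d j)\<^sup>2 * (A powr (- (1 + p)) * A powr (1 + p))"
      by (simp add: c_def mult_ac)
    also have "A powr (- (1 + p)) * A powr (1 + p) = 1" using A by (simp flip: powr_add)
    finally show ?thesis by simp
  qed
  define x where "x j = w j / \<alpha>" for j
  define r where "r = c * \<alpha> powr p"
  \<comment> \<open>The recursion leads from \<open>w 0\<close> to \<open>w (n - 1)\<close>, hence
    the count \<open>n - 1\<close>.\<close>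
  have "real (n - 1) \<le> 1 + ln (1 / (1 - \<beta>)) + 4 / (p * r)"
  proof (rule null_step_count)
    show "0 < r" using c \<alpha> by (simp add: r_def)
    show "1 \<le> 1 / (1 - \<beta>)" using \<beta> by simp
    show "0 \<le> x j" if "j \<le> n - 1" for j
      using that False w_nonneg[of j] \<alpha> by (auto simp: x_def)
    show "x (Suc j) + r * max 1 (x (Suc j)) powr (1 + p) \<le> x j" if "j < n - 1" for j
    proof -
      let ?M = "max \<alpha> (w (Suc j))"
      have j: "Suc j < n" using that by simp
      have "c * ?M powr (1 + p) \<le> \<rho> / 2 * (d (Suc j))\<^sup>2"
        using \<alpha> w_le_e[OF j] e_gt[OF j] j by (intro d_ge) (auto simp: \<alpha>_def)
      then have "w (Suc j) + c * ?M powr (1 + p) \<le> w j" using w_step[OF j] by linarith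
      then have "(w (Suc j) + c * ?M powr (1 + p)) / \<alpha> \<le> w j / \<alpha>"
        using \<alpha> by (intro divide_right_mono) auto
      moreover have "?M = \<alpha> * max 1 (x (Suc j))"
        using \<alpha> by (simp add: x_def max_def field_simps)
      moreover have "c * (\<alpha> * max 1 (x (Suc j))) powr (1 + p) / \<alpha> = r * max 1 (x (Suc j)) powr (1 + p)"
        using \<alpha> by (simp add: r_def powr_mult powr_add)
      ultimately show ?thesis by (simp add: x_def add_divide_distrib)
    qed
    \<comment> \<open>A steep start makes the first step so long that
      \<open>2 * w 0 \<le> gain y + w 0\<close>.\<close>
    show "x 0 \<le> 1 / (1 - \<beta>)" if "2 \<le> r * x 0 powr p"
    proof -
      have n: "0 < n" using False by simp
      have w0: "0 \<le> w 0" using w_nonneg n by simp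
      have "r * x 0 powr p = c * w 0 powr p"
        using \<alpha> w0 by (simp add: r_def x_def powr_divide)
      then have "2 * w 0 \<le> c * w 0 powr p * w 0" using that w0 by (intro mult_right_mono) auto
      also have "\<dots> = c * w 0 powr (1 + p)" using w0 p by (cases "w 0 = 0") (auto simp: powr_add)
      also have "\<dots> \<le> \<rho> / 2 * (d 0)\<^sup>2" using w0 w_le_e n by (intro d_ge) auto
      also have "\<dots> \<le> gain y + w 0" using d0_le n by simp
      finally have "x 0 \<le> gain y / \<alpha>" using \<alpha> by (simp add: x_def divide_right_mono)
      also have "\<dots> = 1 / (1 - \<beta>)" using v by (simp add: \<alpha>_def)
      finally show ?thesis .
    qed
  qed (use p in auto)
  moreover have "4 / (p * r) \<le> 8 / (1 - \<nu>) * (L powr (1 + p) / \<rho>) * \<alpha> powr (- p)"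
  proof -
    define K where "K = 8 / \<rho> * \<alpha> powr (- p)"
    have "4 / (p * (\<rho> / 2 * inverse a * u)) = a / p * (8 / \<rho> * inverse u)"
      if "0 < a" "0 < u" for a u :: real
      using that p \<rho>_pos by (simp add: divide_simps)
    from this[of "A powr (1 + p)" "\<alpha> powr p"] have "4 / (p * r) = A powr (1 + p) / p * K"
      using A \<alpha> unfolding r_def c_def K_def powr_minus by simp
    also have "\<dots> \<le> L powr (1 + p) / (1 - \<nu>) * K"
    proof (rule mult_right_mono)
      \<comment> \<open>Only the factor \<open>(1 + \<nu>) powr p\<close> is lost; the other
        \<open>1 + \<nu>\<close> in \<open>A powr (1 + p)\<close> cancels against
        \<open>p\<close>.\<close>
      have "1 \<le> (1 + \<nu>) powr p" using \<nu> p by (simp add: ge_one_powr_ge_zero)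
      have "A powr (1 + p) = L powr (1 + p) / ((1 + \<nu>) * (1 + \<nu>) powr p)"
        using L \<nu> by (simp add: A_def powr_divide powr_add)
      then have "A powr (1 + p) / p = L powr (1 + p) / (1 - \<nu>) / (1 + \<nu>) powr p"
        using \<nu> assms by (simp add: p_def)
      also have "\<dots> \<le> L powr (1 + p) / (1 - \<nu>) / 1"
        using \<open>1 \<le> (1 + \<nu>) powr p\<close> assms by (intro divide_left_mono) auto
      finally show "A powr (1 + p) / p \<le> L powr (1 + p) / (1 - \<nu>)" by simp
    qed (use \<rho>_pos in \<open>simp add: K_def\<close>)
    also have "\<dots> = 8 / (1 - \<nu>) * (L powr (1 + p) / \<rho>) * \<alpha> powr (- p)"
      by (simp add: K_def)
    finally show ?thesis .
  qed
  ultimately have "real n \<le> 2 + ln (1 / (1 - \<beta>)) + 8 / (1 - \<nu>) * (L powr (1 + p) / \<rho>) * \<alpha> powr (- p)"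
    using False by linarith
  then show ?thesis unfolding p1(2) \<alpha>_def unfolding p_def .
qed

end

section \<open>Outer iterations\<close>

context composite
begin

text \<open>The model lies below \<open>f\<close>, so its value at \<open>u\<close> is at most
  \<open>moreau y\<close> and the predicted decrease at least \<open>gain y\<close>; the passed test
  secures the fraction \<open>\<beta>\<close> of it.\<close>

lemma descent_step:
  assumes y: "y \<in> edom" and le: "\<And>x. \<phi> x \<le> f x" and "0 < \<beta>"
    and min: "is_arg_min (\<lambda>x. objective \<phi> h x + ereal (\<rho> / 2 * (norm (x - y))\<^sup>2)) (\<lambda>_. True) u"
    and test: "descent_test f h \<beta> y \<phi> u"
  shows "u \<in> edom" "F u \<le> F y - \<beta> * gain y"
proof -
  have min_le: "objective \<phi> h u + ereal (\<rho> / 2 * (norm (u - y))\<^sup>2)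
      \<le> objective \<phi> h x + ereal (\<rho> / 2 * (norm (x - y))\<^sup>2)" for x
    using min by (auto simp: is_arg_min_def not_less)
  show u: "u \<in> edom"
  proof (rule ccontr)
    assume "u \<notin> edom"
    then show False using min_le[of y] y by (simp add: objective_outside objective_eq)
  qed
  have "\<phi> u + hr u \<le> moreau y"
  proof (rule moreau_ge)
    fix x assume x: "x \<in> edom"
    have "\<phi> u + hr u + \<rho> / 2 * (norm (u - y))\<^sup>2 \<le> \<phi> x + hr x + \<rho> / 2 * (norm (x - y))\<^sup>2"
      using min_le[of x] u x by (simp add: objective_eq)
    moreover have "0 \<le> \<rho> / 2 * (norm (u - y))\<^sup>2" using \<rho>_pos by simp
    ultimately show "\<phi> u + hr u \<le> F x + \<rho> / 2 * (norm (x - y))\<^sup>2"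
      using le[of x] unfolding F_def by linarith
  qed
  then have "\<beta> * gain y \<le> \<beta> * (F y - (\<phi> u + hr u))"
    using \<open>0 < \<beta>\<close> by (intro mult_left_mono) (auto simp: gain_def)
  also have "\<dots> \<le> F y - F u"
    using test y u by (simp add: descent_test_def objective_eq F_def)
  finally show "F u \<le> F y - \<beta> * gain y" by simp
qed

text \<open>\<open>bound\<close> is uniform in the number \<open>n\<close> of failed tests, so they
  cannot go on for ever; the additional 1 counts the iteration whose test passes.\<close>

lemma prox_bundle_terminates:
  assumes "0 \<le> \<nu>" "\<nu> \<le> 1" "0 < L" "hoelder_smooth f \<nu> L" "0 < \<beta>" "\<beta> < 1" "y \<in> edom"
    and run: "prox_bundle f h \<rho> y (descent_test f h \<beta> y) z m"
    and bound: "\<And>n. null_steps f h \<rho> \<nu> L \<beta> y z m n \<Longrightarrow> real n + 1 \<le> B"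
  obtains J where "inner_iterations (descent_test f h \<beta> y) z m = enat J" "real J \<le> B"
    "z J \<in> edom" "F (z J) \<le> F y - \<beta> * gain y"
proof -
  define stop where "stop j \<longleftrightarrow> descent_test f h \<beta> y (m j) (z (Suc j))" for j
  have null: "null_steps f h \<rho> \<nu> L \<beta> y z m n" if "\<forall>j<n. \<not> stop j" for n
    using assms that by unfold_locales (auto simp: prox_bundle_def stop_def)
  have ex: "\<exists>j. stop j"
  proof (rule ccontr)
    assume "\<not> ?thesis"
    then have "real (nat \<lceil>B\<rceil>) + 1 \<le> B" by (intro bound null) auto
    then show False by linarith
  qed
  define j where "j = (LEAST j. stop j)"
  have stop: "stop j" using LeastI_ex[OF ex] by (simp add: j_def)
  have before: "\<forall>i<j. \<not> stop i" using not_less_Least by (auto simp: j_def)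
  have j: "admissible_model f h \<rho> y z m j"
    "is_arg_min (\<lambda>x. objective (m j) h x + ereal (\<rho> / 2 * (norm (x - y))\<^sup>2)) (\<lambda>_. True) (z (Suc j))"
    using run before by (auto simp: prox_bundle_def stop_def)
  note step = descent_step[OF \<open>y \<in> edom\<close> _ \<open>0 < \<beta>\<close> j(2) stop[unfolded stop_def]]
  show thesis
  proof (rule that[of "Suc j"])
    show "inner_iterations (descent_test f h \<beta> y) z m = enat (Suc j)"
      using ex by (simp add: inner_iterations_def j_def stop_def)
    show "real (Suc j) \<le> B" using bound[OF null[OF before]] by simp
  qed (use j(1) step in \<open>auto simp: admissible_model_def\<close>)
qed

text \<open>\<open>B\<close> bounds each inner run whose centre has a gap above
  \<open>\<epsilon>\<close>, and \<open>outer_step_count\<close> bounds the number of such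
  centres.\<close>

lemma pbm_total_iterations_le:
  assumes \<nu>: "0 \<le> \<nu>" "\<nu> \<le> 1" and L: "0 < L" "hoelder_smooth f \<nu> L" and \<beta>: "0 < \<beta>" "\<beta> < 1"
    and "0 < D" "0 < \<epsilon>" and y0: "y0 \<in> edom"
    and D: "\<And>x. x \<in> edom \<Longrightarrow> F x \<le> F y0 \<Longrightarrow> infdist x (minimizers (objective f h)) \<le> D"
    and run: "pbm_run f h \<rho> \<beta> y0 y z m"
    and "0 \<le> B"
    and bound: "\<And>y z m n. null_steps f h \<rho> \<nu> L \<beta> y z m n \<Longrightarrow> \<epsilon> < F y - Fmin
      \<Longrightarrow> infdist y (minimizers (objective f h)) \<le> D \<Longrightarrow> real n + 1 \<le> B"
  shows "ereal_of_enat (pbm_total_iterations f h \<beta> \<epsilon> y z m)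
    \<le> ereal (real_of_int (outer_bound \<rho> \<beta> D \<epsilon> (F y0 - Fmin)) * B)"
proof -
  define its where "its = pbm_iterations f h \<beta> y z m"
  define \<delta> where "\<delta> i = F (y i) - Fmin" for i
  \<comment> \<open>The first \<open>k\<close> inner runs end within \<open>B\<close> iterations,
    and the iterates stay in the initial sublevel set, where \<open>D\<close> bounds the distance to
    the minimizers. This persists while the gap exceeds \<open>\<epsilon>\<close>.\<close>
  define inv where "inv k \<longleftrightarrow> (\<forall>i<k. \<exists>J. its i = enat J \<and> real J \<le> B) \<and>
    (\<forall>i\<le>k. y i \<in> edom \<and> F (y i) \<le> F y0) \<and>
    (\<forall>i<k. F (y (Suc i)) \<le> F (y i) - \<beta> * gain (y i))" for k
  have reaches_iff: "pbm_reaches f h \<beta> \<epsilon> y z m k \<longleftrightarrow> \<delta> k \<le> \<epsilon>" if "inv k" for k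
  proof -
    have "its i \<noteq> \<infinity>" if "i < k" for i
      using \<open>inv k\<close> that by (auto simp: inv_def)
    then show ?thesis
      using that by (simp add: pbm_reaches_def inv_def its_def min_value_eq objective_eq \<delta>_def F_def)
  qed
  have inv0: "inv 0" using y0 run by (simp add: inv_def pbm_run_def)
  have inv_Suc: "inv (Suc k)" if inv: "inv k" and gt: "\<epsilon> < \<delta> k" for k
  proof -
    have fin: "\<forall>i<k. its i \<noteq> \<infinity>" using inv by (auto simp: inv_def)
    have yk: "y k \<in> edom" "F (y k) \<le> F y0" using inv by (auto simp: inv_def)
    have pb: "prox_bundle f h \<rho> (y k) (descent_test f h \<beta> (y k)) (z k) (m k)"
      and next_y: "\<And>J. its k = enat J \<Longrightarrow> y (Suc k) = z k J"
      using run fin unfolding pbm_run_def its_def by blast+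
    obtain J where J: "its k = enat J" "real J \<le> B"
      "z k J \<in> edom" "F (z k J) \<le> F (y k) - \<beta> * gain (y k)"
    proof (rule prox_bundle_terminates[OF \<nu> L \<beta> yk(1) pb])
      show "real n + 1 \<le> B" if "null_steps f h \<rho> \<nu> L \<beta> (y k) (z k) (m k) n" for n
        using bound[OF that] gt D yk by (simp add: \<delta>_def)
    qed (simp add: its_def pbm_iterations_def)
    \<comment> \<open>Taking \<open>t = 0\<close> shows that \<open>F\<close> does not increase, so
      the new iterate stays in the sublevel set.\<close>
    have "0 \<le> gain (y k)" using gain_ge[OF yk(1) D[OF yk], of 0] by simp
    then have "F (z k J) \<le> F y0" using J(4) yk(2) \<beta> by (smt (verit) mult_nonneg_nonneg)
    then show ?thesis using inv J next_y[OF J(1)] by (auto simp: inv_def less_Suc_eq le_Suc_eq)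
  qed
  define N1 where "N1 = nat \<lceil>log_plus (\<delta> 0 / (\<rho> * D\<^sup>2)) / ln (1 / (1 - \<beta> / 2))\<rceil>"
  define N2 where "N2 = nat \<lceil>2 * (\<rho> * D\<^sup>2) / (\<beta> * \<epsilon>)\<rceil>"
  have ex: "\<exists>k\<le>N1 + N2. pbm_reaches f h \<beta> \<epsilon> y z m k"
  proof (rule ccontr)
    assume none: "\<not> ?thesis"
    have inv: "inv k \<and> \<epsilon> < \<delta> k" if "k \<le> N1 + N2" for k
      using that
    proof (induction k)
      case 0
      then show ?case using none inv0 reaches_iff[OF inv0] by (auto simp: not_le)
    next
      case (Suc k)
      then have "inv (Suc k)" using inv_Suc by simp
      moreover have "\<not> pbm_reaches f h \<beta> \<epsilon> y z m (Suc k)" using none Suc.prems by blast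
      ultimately show ?case using reaches_iff[of "Suc k"] by (simp add: not_le)
    qed
    \<comment> \<open>\<open>outer_step_count\<close> with \<open>K = N1 + N2\<close>, all gaps up
      to that index being above \<open>\<epsilon>\<close>.\<close>
    have "N1 + N2 < N1 + N2"
      unfolding N1_def N2_def
    proof (rule outer_step_count)
      show "0 < \<rho> * D\<^sup>2" using \<rho>_pos \<open>0 < D\<close> by simp
      show "\<epsilon> < \<delta> i" if "i \<le> nat \<lceil>log_plus (\<delta> 0 / (\<rho> * D\<^sup>2)) / ln (1 / (1 - \<beta> / 2))\<rceil> + nat \<lceil>2 * (\<rho> * D\<^sup>2) / (\<beta> * \<epsilon>)\<rceil>" for i
        using inv[of i] that unfolding N1_def N2_def by blast
      show "\<delta> (Suc i) \<le> \<delta> i - \<beta> * (t * \<delta> i - \<rho> * D\<^sup>2 / 2 * t\<^sup>2)"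
        if "i < nat \<lceil>log_plus (\<delta> 0 / (\<rho> * D\<^sup>2)) / ln (1 / (1 - \<beta> / 2))\<rceil> + nat \<lceil>2 * (\<rho> * D\<^sup>2) / (\<beta> * \<epsilon>)\<rceil>"
          "0 \<le> t" "t \<le> 1" for i t
      proof -
        have "inv (Suc i)" using inv[of "Suc i"] that(1) unfolding N1_def N2_def by simp
        then have i: "y i \<in> edom" "F (y i) \<le> F y0" "F (y (Suc i)) \<le> F (y i) - \<beta> * gain (y i)"
          by (auto simp: inv_def)
        have "\<beta> * (t * \<delta> i - \<rho> * D\<^sup>2 / 2 * t\<^sup>2) \<le> \<beta> * gain (y i)"
          unfolding \<delta>_def using \<beta> that i D by (intro mult_left_mono gain_ge) auto
        then show ?thesis using i(3) by (simp add: \<delta>_def)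
      qed
    qed (use \<beta> \<open>0 < \<epsilon>\<close> in auto)
    then show False by simp
  qed
  define K where "K = (LEAST K. pbm_reaches f h \<beta> \<epsilon> y z m K)"
  have "K \<le> N1 + N2" using ex Least_le unfolding K_def by (metis order_trans)
  have before: "\<not> pbm_reaches f h \<beta> \<epsilon> y z m k" if "k < K" for k
    using not_less_Least that unfolding K_def by blast
  have "inv k" if "k \<le> K" for k
    using that
  proof (induction k)
    case (Suc k)
    then show ?case using inv_Suc[of k] before[of k] reaches_iff[of k] by (simp add: not_le)
  qed (rule inv0)
  from this[of K] obtain J where J: "\<And>i. i < K \<Longrightarrow> its i = enat (J i) \<and> real (J i) \<le> B"
    unfolding inv_def by (metis order_refl)
  have "pbm_total_iterations f h \<beta> \<epsilon> y z m = (\<Sum>k<K. its k)"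
    using ex by (auto simp: pbm_total_iterations_def K_def its_def)
  also have "\<dots> = (\<Sum>k<K. enat (J k))" using J by (intro sum.cong) auto
  also have "\<dots> = enat (\<Sum>k<K. J k)" by (simp add: of_nat_eq_enat[symmetric])
  finally have total: "ereal_of_enat (pbm_total_iterations f h \<beta> \<epsilon> y z m) = ereal (\<Sum>k<K. real (J k))"
    by simp
  have "(\<Sum>k<K. real (J k)) \<le> (\<Sum>k<K. B)" using J by (intro sum_mono) auto
  also have "\<dots> = real K * B" by simp
  also have "\<dots> \<le> real (N1 + N2) * B" using \<open>K \<le> N1 + N2\<close> \<open>0 \<le> B\<close> by (intro mult_right_mono) auto
  also have "real (N1 + N2) = real_of_int (outer_bound \<rho> \<beta> D \<epsilon> (F y0 - Fmin))"
  proof -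
    \<comment> \<open>Both ceilings are nonnegative, so the truncation by \<open>nat\<close> changes
      nothing.\<close>
    have "0 \<le> log_plus (\<delta> 0 / (\<rho> * D\<^sup>2)) / ln (1 / (1 - \<beta> / 2))"
      using \<beta> by (simp add: log_plus_def)
    then have "real N1 = real_of_int \<lceil>log_plus (\<delta> 0 / (\<rho> * D\<^sup>2)) / ln (1 / (1 - \<beta> / 2))\<rceil>"
      unfolding N1_def by (intro of_nat_nat) linarith
    moreover have "0 \<le> 2 * (\<rho> * D\<^sup>2) / (\<beta> * \<epsilon>)"
      using \<beta> \<rho>_pos \<open>0 < \<epsilon>\<close> by simp
    then have "real N2 = real_of_int \<lceil>2 * (\<rho> * D\<^sup>2) / (\<beta> * \<epsilon>)\<rceil>"
      unfolding N2_def by (intro of_nat_nat) linarith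
    moreover have "\<delta> 0 = F y0 - Fmin" using run by (simp add: \<delta>_def pbm_run_def)
    ultimately show ?thesis by (simp add: outer_bound_def mult.assoc)
  qed
  finally show ?thesis unfolding total by simp
qed

end

section \<open>Assembly of the two complexity bounds\<close>

theorem theorem1:
  fixes f :: "real ^ 'n \<Rightarrow> real" and h :: "real ^ 'n \<Rightarrow> ereal"
    and \<nu> L \<rho> \<beta> D \<epsilon> :: real
    and y0 :: "real ^ 'n"
    and y :: "nat \<Rightarrow> real ^ 'n"
    and z :: "nat \<Rightarrow> nat \<Rightarrow> real ^ 'n"
    and m :: "nat \<Rightarrow> nat \<Rightarrow> real ^ 'n \<Rightarrow> real"
  assumes "convex_on UNIV f"
    and "proper_fun h" and "lsc_fun h" and "convex_fun h"
    and "minimizers (objective f h) \<noteq> {}"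
    and "0 \<le> \<nu>" and "\<nu> \<le> 1" and "L > 0" and "hoelder_smooth f \<nu> L"
    and "objective f h y0 < \<infinity>" and "\<rho> > 0" and "0 < \<beta>" and "\<beta> < 1"
    and "D > 0"
    and "(SUP x\<in>{x. objective f h x \<le> objective f h y0}.
            ereal (infdist x (minimizers (objective f h)))) \<le> ereal D"
    and "0 < \<epsilon>" and "ereal \<epsilon> < objective f h y0 - min_value (objective f h)"
    and "pbm_run f h \<rho> \<beta> y0 y z m"
  defines "T_total \<equiv> ereal_of_enat (pbm_total_iterations f h \<beta> \<epsilon> y z m)"
    and "T_outer \<equiv> real_of_int (outer_bound \<rho> \<beta> D \<epsilon>
           (real_of_ereal (objective f h y0 - min_value (objective f h))))"
  shows "(\<nu> = 1 \<longrightarrow>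
            T_total \<le> ereal (T_outer *
              (2 + real_of_int \<lceil>log_plus (L\<^sup>2 / ((1 - \<beta>) * \<rho>\<^sup>2)) / ln (1 + \<rho> / L)\<rceil>))) \<and>
         (\<nu> < 1 \<longrightarrow>
            T_total \<le> ereal (T_outer *
              (3 + 4 * ln (1 / (1 - \<beta>))
                 + 8 / (1 - \<nu>)
                   * (L powr (2 / (1 + \<nu>)) / (\<rho> * (1 - \<beta>) powr ((1 - \<nu>) / (1 + \<nu>))))
                   * (2 * max (\<rho> * D\<^sup>2) \<epsilon> / \<epsilon>\<^sup>2) powr ((1 - \<nu>) / (1 + \<nu>)))))"
proof -
  interpret composite f h \<rho>
    by unfold_locales (use assms in auto)
  have y0: "y0 \<in> edom"
    using \<open>objective f h y0 < \<infinity>\<close> by (rule iffD1[OF objective_finite_iff])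
  have gap: "objective f h y0 - min_value (objective f h) = ereal (F y0 - Fmin)"
    using y0 by (simp add: min_value_eq objective_eq F_def)
  have D: "infdist x (minimizers (objective f h)) \<le> D" if "x \<in> edom" "F x \<le> F y0" for x
  proof -
    have "ereal (infdist x (minimizers (objective f h))) \<le> ereal D"
      using that y0 by (intro SUP_upper2[THEN order_trans, OF _ order_refl assms(15)])
        (simp add: objective_eq F_def)
    then show ?thesis by simp
  qed
  define M where "M = max (\<rho> * D\<^sup>2) \<epsilon>"
  have M: "0 < M" using \<open>0 < \<epsilon>\<close> by (simp add: M_def)
  have gain: "\<epsilon>\<^sup>2 / (2 * M) \<le> gain c" "0 < gain c"
    if "null_steps f h \<rho> \<nu> L \<beta> c z' m' n" "\<epsilon> < F c - Fmin"
      "infdist c (minimizers (objective f h)) \<le> D" for c z' m' n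
  proof -
    have "c \<in> edom" using that(1) by (rule null_steps.y)
    then show "\<epsilon>\<^sup>2 / (2 * M) \<le> gain c"
      unfolding M_def using that assms by (intro gain_pos)
    moreover have "0 < \<epsilon>\<^sup>2 / (2 * M)" using M \<open>0 < \<epsilon>\<close> by simp
    ultimately show "0 < gain c" by linarith
  qed
  \<comment> \<open>Both cases reduce to a bound on one more than the number of consecutive failed
    tests.\<close>
  have main: "T_total \<le> ereal (T_outer * B)"
    if "0 \<le> B" and "\<And>c z m n. null_steps f h \<rho> \<nu> L \<beta> c z m n \<Longrightarrow> \<epsilon> < F c - Fmin
      \<Longrightarrow> infdist c (minimizers (objective f h)) \<le> D \<Longrightarrow> real n + 1 \<le> B" for B
    unfolding T_total_def T_outer_def gap real_of_ereal.simps
    using assms y0 D that by (intro pbm_total_iterations_le)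
  show ?thesis
  proof (intro conjI impI main)
    assume "\<nu> = 1"
    have "0 \<le> log_plus (L\<^sup>2 / ((1 - \<beta>) * \<rho>\<^sup>2)) / ln (1 + \<rho> / L)"
      using \<open>L > 0\<close> \<open>\<rho> > 0\<close> by (simp add: log_plus_def)
    then show "0 \<le> 2 + real_of_int \<lceil>log_plus (L\<^sup>2 / ((1 - \<beta>) * \<rho>\<^sup>2)) / ln (1 + \<rho> / L)\<rceil>"
      by linarith
    fix c z m n
    assume ns: "null_steps f h \<rho> \<nu> L \<beta> c z m n" "\<epsilon> < F c - Fmin"
      "infdist c (minimizers (objective f h)) \<le> D"
    then show "real n + 1 \<le> 2 + real_of_int \<lceil>log_plus (L\<^sup>2 / ((1 - \<beta>) * \<rho>\<^sup>2)) / ln (1 + \<rho> / L)\<rceil>"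
      using null_steps.null_step_bound_smooth[OF ns(1) \<open>\<nu> = 1\<close> gain(2)[OF ns]] by linarith
  next
    assume "\<nu> < 1"
    define p where "p = (1 - \<nu>) / (1 + \<nu>)"
    define K where "K = 8 / (1 - \<nu>) * (L powr (2 / (1 + \<nu>)) / \<rho>)"
    define B where "B = 3 + 4 * ln (1 / (1 - \<beta>)) + K * ((1 - \<beta>) powr (- p) * (2 * M / \<epsilon>\<^sup>2) powr p)"
    have p: "0 < p" using \<open>0 \<le> \<nu>\<close> \<open>\<nu> < 1\<close> by (simp add: p_def)
    have K: "0 \<le> K" using \<open>\<nu> < 1\<close> \<open>\<rho> > 0\<close> by (simp add: K_def)
    have ln: "0 \<le> ln (1 / (1 - \<beta>))" using \<open>0 < \<beta>\<close> \<open>\<beta> < 1\<close> by simp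
    have B_eq: "3 + 4 * ln (1 / (1 - \<beta>))
                 + 8 / (1 - \<nu>)
                   * (L powr (2 / (1 + \<nu>)) / (\<rho> * (1 - \<beta>) powr ((1 - \<nu>) / (1 + \<nu>))))
                   * (2 * max (\<rho> * D\<^sup>2) \<epsilon> / \<epsilon>\<^sup>2) powr ((1 - \<nu>) / (1 + \<nu>)) = B"
      unfolding B_def K_def p_def[symmetric] M_def[symmetric] by (simp add: powr_minus divide_inverse)
    show "0 \<le> 3 + 4 * ln (1 / (1 - \<beta>))
                 + 8 / (1 - \<nu>)
                   * (L powr (2 / (1 + \<nu>)) / (\<rho> * (1 - \<beta>) powr ((1 - \<nu>) / (1 + \<nu>))))
                   * (2 * max (\<rho> * D\<^sup>2) \<epsilon> / \<epsilon>\<^sup>2) powr ((1 - \<nu>) / (1 + \<nu>))"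
      unfolding B_eq using K ln by (simp add: B_def)
    fix c z m n
    assume ns: "null_steps f h \<rho> \<nu> L \<beta> c z m n" "\<epsilon> < F c - Fmin"
      "infdist c (minimizers (objective f h)) \<le> D"
    have "((1 - \<beta>) * gain c) powr (- p) = (1 - \<beta>) powr (- p) * gain c powr (- p)"
      using gain(2)[OF ns] \<open>\<beta> < 1\<close> by (simp add: powr_mult)
    also have "gain c powr (- p) \<le> (\<epsilon>\<^sup>2 / (2 * M)) powr (- p)"
      using gain(1)[OF ns] M \<open>0 < \<epsilon>\<close> p by (intro powr_mono2') auto
    also have "(\<epsilon>\<^sup>2 / (2 * M)) powr (- p) = (2 * M / \<epsilon>\<^sup>2) powr p"
      using M \<open>0 < \<epsilon>\<close> by (simp add: powr_minus powr_divide)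
    finally have "K * ((1 - \<beta>) * gain c) powr (- p) \<le> K * ((1 - \<beta>) powr (- p) * (2 * M / \<epsilon>\<^sup>2) powr p)"
      using K by (intro mult_left_mono) (auto simp: mult_left_mono)
    moreover have "real n \<le> 2 + ln (1 / (1 - \<beta>)) + K * ((1 - \<beta>) * gain c) powr (- p)"
      using null_steps.null_step_bound_hoelder[OF ns(1) \<open>\<nu> < 1\<close> gain(2)[OF ns]]
      by (simp only: K_def p_def)
    \<comment> \<open>The passing iteration raises the 2 to 3; the coefficient 4 in place of 1 is
      slack, as the logarithm is nonnegative.\<close>
    ultimately have "real n + 1 \<le> B" using ln unfolding B_def by linarith
    then show "real n + 1 \<le> 3 + 4 * ln (1 / (1 - \<beta>))
                 + 8 / (1 - \<nu>)
                   * (L powr (2 / (1 + \<nu>)) / (\<rho> * (1 - \<beta>) powr ((1 - \<nu>) / (1 + \<nu>))))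
                   * (2 * max (\<rho> * D\<^sup>2) \<epsilon> / \<epsilon>\<^sup>2) powr ((1 - \<nu>) / (1 + \<nu>))"
      unfolding B_eq .
  qed
qed

end
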